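(* The translation of CGV into APCP preserves typing up to priority checks: (1) for every derivation of $\Gamma\vdash_{\mathtt M}M:T$, the translated process satisfies $[\![M]\!]z\vdash^{*}\overline{[\![\Gamma]\!]},\,z:[\![T]\!]$; (2) for every derivation of $\Gamma\vdash^{\phi}_{\mathtt C}C:T$, the translated process satisfies $[\![C]\!]z\vdash^{*}\overline{[\![\Gamma]\!]},\,z:[\![T]\!]$; (3) for every derivation of $\Gamma\vdash_{\mathtt B}[\vec m\rangle:S'>S$ and every process $P$ with $P\vdash^{*}\Lambda,\,x:\overline{[\![S']\!]}$, the translated process satisfies $[\![\,[\vec m\rangle\,]\!]_x^{P}\vdash^{*}\overline{[\![\Gamma]\!]},\,\Lambda,\,x:\overline{[\![S]\!]}$.
   Context: **CGV (runtime) terms.** $x,y,\ldots$ are variables; $\ell,i,j$ labels; $I$ a set of labels. $L,M,N ::= x \mid () \mid \lambda x.M \mid M\,N \mid (M,N) \mid \mathsf{let}\,(x,y)=M\,\mathsf{in}\,N \mid \mathsf{new} \mid \mathsf{spawn}\,M \mid \mathsf{send}\,M \mid \mathsf{recv}\,M \mid \mathsf{select}\,\ell\,M \mid \mathsf{case}\,M\,\mathsf{of}\,\{i:M_i\}_{i\in I} \mid M\{\!\{N/x\}\!\} \mid \mathsf{send}'(M,N)$. $\lambda x.M$ binds $x$ in $M$; $\mathsf{let}$ binds $x,y$ in $N$; the explicit substitution $M\{\!\{N/x\}\!\}$ binds $x$ in $M$. **Configurations.** Markers $\phi ::= \mathsf{main}\mid\lozenge$. Messages $m ::= M\mid\ell$;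 $\vec m$ is a finite sequence of messages, $\epsilon$ the empty one. $C,D ::= \phi\,M \mid C\parallel D \mid (\nu x[\vec m\rangle y)C \mid C\{\!\{M/x\}\!\}$, where $(\nu x[\vec m\rangle y)C$ binds $x,y$ and $C\{\!\{M/x\}\!\}$ binds $x$ in $C$. **CGV types.** $T,U ::= T\times U\mid T\multimap U\mid\mathbf 1\mid S$; $S ::= {!}T.S\mid{?}T.S\mid\oplus\{i:S_i\}_{i\in I}\mid\&\{i:S_i\}_{i\in I}\mid\mathsf{end}$. Duality: $\overline{!T.S}={?}T.\overline S$, $\overline{?T.S}={!}T.\overline S$, $\overline{\oplus\{i:S_i\}}=\&\{i:\overline{S_i}\}$, $\overline{\&\{i:S_i\}}=\oplus\{i:\overline{S_i}\}$, $\overline{\mathsf{end}}=\mathsf{end}$. Environments $\Gamma,\Delta$ assign types to distinct variables; $\Gamma,\Delta$ presupposes disjoint domains. **Term typing** (premises $\Rightarrow$ conclusion): T-Var: $x:T\vdash_{\mathtt M}x:T$. T-Abs: $\Gamma,x:T\vdash_{\mathtt M}M:U\Rightarrow\Gamma\vdash_{\mathtt M}\lambda x.M:T\multimap U$. T-App: $\Gamma\vdash_{\mathtt M}M:T\multimap U$, $\Delta\vdash_{\mathtt M}N:T\Rightarrow\Gamma,\Delta\vdash_{\mathtt M}M\,N:U$. T-Unit: $\emptyset\vdash_{\mathtt M}():\mathbf 1$. T-Pair: $\Gamma\vdash_{\mathtt M}M:T$, $\Delta\vdash_{\mathtt M}N:U\Rightarrow\Gamma,\Delta\vdash_{\mathtt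 M}(M,N):T\times U$. T-Split: $\Gamma\vdash_{\mathtt M}M:T\times T'$, $\Delta,x:T,y:T'\vdash_{\mathtt M}N:U\Rightarrow\Gamma,\Delta\vdash_{\mathtt M}\mathsf{let}\,(x,y)=M\,\mathsf{in}\,N:U$. T-New: $\emptyset\vdash_{\mathtt M}\mathsf{new}:S\times\overline S$. T-Spawn: $\Gamma\vdash_{\mathtt M}M:\mathbf 1\times T\Rightarrow\Gamma\vdash_{\mathtt M}\mathsf{spawn}\,M:T$. T-EndL: $\Gamma\vdash_{\mathtt M}M:T\Rightarrow\Gamma,x:\mathsf{end}\vdash_{\mathtt M}M:T$. T-EndR: $\emptyset\vdash_{\mathtt M}x:\mathsf{end}$. T-Send: $\Gamma\vdash_{\mathtt M}M:T\times{!}T.S\Rightarrow\Gamma\vdash_{\mathtt M}\mathsf{send}\,M:S$. T-Recv: $\Gamma\vdash_{\mathtt M}M:{?}T.S\Rightarrow\Gamma\vdash_{\mathtt M}\mathsf{recv}\,M:T\times S$. T-Select: $\Gamma\vdash_{\mathtt M}M:\oplus\{i:T_i\}_{i\in I}$, $j\in I\Rightarrow\Gamma\vdash_{\mathtt M}\mathsf{select}\,j\,M:T_j$. T-Case: $\Gamma\vdash_{\mathtt M}M:\&\{i:T_i\}_{i\in I}$, $\forall i\in I.\ \Delta\vdash_{\mathtt M}N_i:T_i\multimap U\Rightarrow\Gamma,\Delta\vdash_{\mathtt M}\mathsf{case}\,M\,\mathsf{of}\,\{i:N_i\}_{i\in I}:U$. T-Sub: $\Gamma,x:T\vdash_{\mathtt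 M}M:U$, $\Delta\vdash_{\mathtt M}N:T\Rightarrow\Gamma,\Delta\vdash_{\mathtt M}M\{\!\{N/x\}\!\}:U$. T-Send': $\Gamma\vdash_{\mathtt M}M:T$, $\Delta\vdash_{\mathtt M}N:{!}T.S\Rightarrow\Gamma,\Delta\vdash_{\mathtt M}\mathsf{send}'(M,N):S$. **Buffer typing**: T-Buf: $\emptyset\vdash_{\mathtt B}[\epsilon\rangle:S'>S'$. T-BufSend: $\Gamma\vdash_{\mathtt M}M:T$, $\Delta\vdash_{\mathtt B}[\vec m\rangle:S'>S\Rightarrow\Gamma,\Delta\vdash_{\mathtt B}[\vec m,M\rangle:S'>{!}T.S$. T-BufSelect: $\Gamma\vdash_{\mathtt B}[\vec m\rangle:S'>S_j$, $j\in I\Rightarrow\Gamma\vdash_{\mathtt B}[\vec m,j\rangle:S'>\oplus\{i:S_i\}_{i\in I}$. **Configuration typing**, with $\mathsf{main}+\lozenge=\lozenge+\mathsf{main}=\mathsf{main}$, $\lozenge+\lozenge=\lozenge$, $\mathsf{main}+\mathsf{main}$ undefined: T-Main: $\Gamma\vdash_{\mathtt M}M:T\Rightarrow\Gamma\vdash^{\mathsf{main}}_{\mathtt C}\mathsf{main}\,M:T$. T-Child: $\Gamma\vdash_{\mathtt M}M:\mathbf 1\Rightarrow\Gamma\vdash^{\lozenge}_{\mathtt C}\lozenge\,M:\mathbf 1$. T-ParL: $\Gamma\vdash^{\lozenge}_{\mathtt C}C:\mathbf 1$, $\Delta\vdash^\phi_{\mathtt C}D:T\Rightarrow\Gamma,\Delta\vdash^{\lozenge+\phi}_{\mathtt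 C}C\parallel D:T$. T-ParR: $\Gamma\vdash^\phi_{\mathtt C}C:T$, $\Delta\vdash^{\lozenge}_{\mathtt C}D:\mathbf 1\Rightarrow\Gamma,\Delta\vdash^{\phi+\lozenge}_{\mathtt C}C\parallel D:T$. T-Res: $\Gamma\vdash_{\mathtt B}[\vec m\rangle:S'>S$, $\Delta,x:S',y:\overline S\vdash^\phi_{\mathtt C}C:T\Rightarrow\Gamma,\Delta\vdash^\phi_{\mathtt C}(\nu x[\vec m\rangle y)C:T$. T-ResBuf: $\Gamma,y:\overline S\vdash_{\mathtt B}[\vec m\rangle:S'>S$, $\Delta,x:S'\vdash^\phi_{\mathtt C}C:T\Rightarrow\Gamma,\Delta\vdash^\phi_{\mathtt C}(\nu x[\vec m\rangle y)C:T$. T-ConfSub: $\Gamma,x:T\vdash^\phi_{\mathtt C}C:U$, $\Delta\vdash_{\mathtt M}M:T\Rightarrow\Gamma,\Delta\vdash^\phi_{\mathtt C}C\{\!\{M/x\}\!\}:U$. **APCP processes.** $P,Q ::= x[y,z]\mid x(y,z).P\mid x[z]\triangleleft i\mid x(z)\triangleright\{i:P_i\}_{i\in I}\mid(\nu xy)P\mid P\,|\,Q\mid\mathbf 0\mid x\leftrightarrow y$ (output, input, selection, branching, restriction, parallel, inaction, forwarder). Input binds $y,z$, branching binds $z$, restriction binds $x,y$. A restriction may carry a decoration, written $(\overset{\leftrightarrow}{\nu}xy)P$, which is irrelevant for typing (typed as $(\nu xy)P$). **APCP types and $\vdash^*$.** $A,B ::= A\otimes B\mid A\wp B\mid\oplus\{i:A_i\}_{i\in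 I}\mid\&\{i:A_i\}_{i\in I}\mid\bullet$ (here $\wp$ is linear logic's par). In APCP the connectives other than $\bullet$ carry priority annotations constrained by side conditions in the rules for $\wp$ and $\&$; the judgment $\vdash^*$ is APCP typing with those side conditions erased, and annotations are therefore omitted. Duality: $\overline{A\otimes B}=\overline A\wp\overline B$, $\overline{A\wp B}=\overline A\otimes\overline B$, $\overline{\oplus\{i:A_i\}}=\&\{i:\overline{A_i}\}$, $\overline{\&\{i:A_i\}}=\oplus\{i:\overline{A_i}\}$, $\overline\bullet=\bullet$. Contexts are finite unordered assignments of types to distinct names. Rules: $\mathbf 0\vdash^*\emptyset$; $P\vdash^*\Gamma\Rightarrow P\vdash^*\Gamma,x:\bullet$; $x\leftrightarrow y\vdash^*x:\overline A,y:A$; $P\vdash^*\Gamma$, $Q\vdash^*\Delta\Rightarrow P\,|\,Q\vdash^*\Gamma,\Delta$; $P\vdash^*\Gamma,x:A,y:\overline A\Rightarrow(\nu xy)P\vdash^*\Gamma$; $x[y,z]\vdash^*x:A\otimes B,y:\overline A,z:\overline B$; $P\vdash^*\Gamma,y:A,z:B\Rightarrow x(y,z).P\vdash^*\Gamma,x:A\wp B$; $j\in I\Rightarrow x[z]\triangleleft j\vdash^*x:\oplus\{i:A_i\}_{i\in I},z:\overline{A_j}$; $\forall i\in I.\ P_i\vdash^*\Gamma,z:A_i\Rightarrow x(z)\triangleright\{i:P_i\}_{i\in I}\vdash^*\Gamma,x:\&\{i:A_i\}_{i\in I}$. **Translation of types.** $[\![T\times U]\!]=([\![T]\!]\wp\bullet)\otimes([\![U]\!]\wp\bullet)$;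 $[\![T\multimap U]\!]=(\overline{[\![T]\!]}\otimes\bullet)\wp[\![U]\!]$; $[\![\mathbf 1]\!]=\bullet$; $[\![{!}T.S]\!]=(\overline{[\![T]\!]}\otimes\bullet)\wp[\![S]\!]$; $[\![{?}T.S]\!]=([\![T]\!]\wp\bullet)\otimes[\![S]\!]$; $[\![\oplus\{i:T_i\}]\!]=\&\{i:[\![T_i]\!]\}$; $[\![\&\{i:T_i\}]\!]=\oplus\{i:[\![T_i]\!]\}$; $[\![\mathsf{end}]\!]=\bullet$. Extended pointwise to environments; $\overline{[\![\Gamma]\!]}$ dualizes each type. **Translation of derivations.** Defined by recursion on typing derivations; $[\![M]\!]z$, $[\![C]\!]z$ denote the resulting process (with $z$ the name on which the type is provided), by abuse of notation mentioning only the subject. Introduced names are fresh. By last rule: T-Var: $[\![x]\!]z=x\leftrightarrow z$. T-Unit: $[\![()]\!]z=\mathbf 0$. T-EndR: $[\![x]\!]z=\mathbf 0$. T-EndL: $[\![M]\!]z$ unchanged from the premise. T-Abs: $[\![\lambda x.M]\!]z=z(a,b).(\overset{\leftrightarrow}{\nu}cx)((\nu ef)a[c,e]\,|\,[\![M]\!]b)$. T-App: $[\![M\,N]\!]z=(\nu ab)([\![M]\!]a\,|\,(\nu cd)(b[c,z]\,|\,d(e,f).[\![N]\!]e))$. T-Pair: $[\![(M,N)]\!]z=(\nu ab)(\nu cd)(z[a,c]\,|\,b(e,f).[\![M]\!]e\,|\,d(g,h).[\![N]\!]g)$. T-Split: $[\![\mathsf{let}\,(x,y)=M\,\mathsf{in}\,N]\!]z=(\nu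 ab)([\![M]\!]a\,|\,b(c,d).(\overset{\leftrightarrow}{\nu}ex)(\overset{\leftrightarrow}{\nu}fy)((\nu gh)c[e,g]\,|\,(\nu kl)d[f,k]\,|\,[\![N]\!]z))$. T-New: $[\![\mathsf{new}]\!]z=(\nu ab)((\nu cd)a[c,d]\,|\,b(e,f).(\nu xy)[\![(x,y)]\!]z)$. T-Spawn: $[\![\mathsf{spawn}\,M]\!]z=(\nu ab)([\![M]\!]a\,|\,b(c,d).((\nu ef)c[e,f]\,|\,(\nu gh)d[z,g]))$. T-Send: $[\![\mathsf{send}\,M]\!]z=(\nu ab)([\![M]\!]a\,|\,b(c,d).(\nu ef)((\nu gh)d[e,g]\,|\,(\nu kl)(f[c,k]\,|\,l\leftrightarrow z)))$. T-Recv: $[\![\mathsf{recv}\,M]\!]z=(\nu ab)([\![M]\!]a\,|\,b(c,d).(\nu ef)(z[c,e]\,|\,f(g,h).d\leftrightarrow g))$. T-Select: $[\![\mathsf{select}\,j\,M]\!]z=(\nu ab)([\![M]\!]a\,|\,(\nu cd)(b[c]\triangleleft j\,|\,d\leftrightarrow z))$. T-Case: $[\![\mathsf{case}\,M\,\mathsf{of}\,\{i:N_i\}_{i\in I}]\!]z=(\nu ab)([\![M]\!]a\,|\,b(c)\triangleright\{i:[\![N_i\,c]\!]z\}_{i\in I})$. T-Sub: $[\![M\{\!\{N/x\}\!\}]\!]z=(\overset{\leftrightarrow}{\nu}xa)([\![M]\!]z\,|\,[\![N]\!]a)$. T-Send': $[\![\mathsf{send}'(M,N)]\!]z=(\nu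 ab)(a(c,d).[\![M]\!]c\,|\,(\nu ef)([\![N]\!]e\,|\,(\nu gh)(f[b,g]\,|\,h\leftrightarrow z)))$. T-Main/T-Child: $[\![\phi\,M]\!]z=[\![M]\!]z$. T-ParL: $[\![C\parallel D]\!]z=(\nu ab)[\![C]\!]a\,|\,[\![D]\!]z$. T-ParR: $[\![C\parallel D]\!]z=[\![C]\!]z\,|\,(\nu ab)[\![D]\!]a$. T-Res/T-ResBuf: $[\![(\nu x[\vec m\rangle y)C]\!]z=(\nu xy)\,[\![\,[\vec m\rangle\,]\!]_x^{[\![C]\!]z}$. T-ConfSub: $[\![C\{\!\{M/x\}\!\}]\!]z=(\overset{\leftrightarrow}{\nu}xa)([\![C]\!]z\,|\,[\![M]\!]a)$. Buffers, with parameters a name $x$ and a process $P$ typed $P\vdash^*\Lambda,x:\overline{[\![S']\!]}$: T-Buf: $[\![\,[\epsilon\rangle\,]\!]_x^P=P$. T-BufSend: $[\![\,[\vec m,M\rangle\,]\!]_x^P=(\nu ab)(\nu cd)((\nu gh)(x\leftrightarrow g\,|\,h[a,c])\,|\,b(e,f).[\![M]\!]e\,|\,[\![\,[\vec m\rangle\,]\!]_d^{P\{d/x\}})$. T-BufSelect: $[\![\,[\vec m,j\rangle\,]\!]_x^P=(\nu ab)((\nu cd)(x\leftrightarrow c\,|\,d[a]\triangleleft j)\,|\,[\![\,[\vec m\rangle\,]\!]_b^{P\{b/x\}})$. *)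

theory Defs
  imports Main
begin

section \<open>Names, labels, contexts\<close>

text \<open>
  CGV variables and APCP names are the same infinite set, since the translation reuses
  variables as names. A context is a finite partial map; \<open>\<Gamma>, x : T\<close> is rendered as
  \<open>\<Gamma>(x \<mapsto> T)\<close> with the premise \<open>x \<notin> dom \<Gamma>\<close>, and \<open>\<Gamma>, \<Delta>\<close> as
  \<open>\<Gamma> ++ \<Delta>\<close> with the premise \<open>\<Gamma> \<bottom> \<Delta>\<close>. A family indexed by a set \<open>I\<close> of labels is a partial map
  on labels with domain \<open>I\<close>.

  Terms, configurations and processes are identified up to renaming of bound names. To this
  end binding is represented in the locally nameless style (\<open>Bound\<close> is a de Bruijn index,
  \<open>Free\<close> a name), and the binders of the calculi are the functions below that take
  the bound names and abstract them from the body, so that alpha-equivalent expressions are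
  equal. Objects with dangling indices are never typable.
\<close>

type_synonym name = nat
type_synonym label = string

datatype ref = Free name | Bound nat

primrec abs_ref :: "nat \<Rightarrow> name \<Rightarrow> ref \<Rightarrow> ref" where
  "abs_ref k x (Free y) = (if y = x then Bound k else Free y)"
| "abs_ref k x (Bound i) = Bound i"

definition disjoint_ctx :: "(name \<rightharpoonup> 'a) \<Rightarrow> (name \<rightharpoonup> 'a) \<Rightarrow> bool" (infix "\<bottom>" 50) where
  "\<Gamma> \<bottom> \<Delta> \<longleftrightarrow> dom \<Gamma> \<inter> dom \<Delta> = {}"

text \<open>An infinite supply of pairwise distinct names outside a finite set.\<close>

definition fresh :: "name set \<Rightarrow> nat \<Rightarrow> name" where
  "fresh A = (SOME \<nu>. inj \<nu> \<and> range \<nu> \<inter> A = {})"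


section \<open>CGV\<close>

subsection \<open>Types\<close>

datatype ty =
    Prod ty ty
  | Lolli ty ty
  | One
  | Session sess
and sess =
    SSend ty sess
  | SRecv ty sess
  | SSelect "label \<Rightarrow> sess option"
  | SBranch "label \<Rightarrow> sess option"
  | SEnd

primrec sdual :: "sess \<Rightarrow> sess" where
  "sdual (SSend T S) = SRecv T (sdual S)"
| "sdual (SRecv T S) = SSend T (sdual S)"
| "sdual (SSelect Ss) = SBranch (map_option sdual \<circ> Ss)"
| "sdual (SBranch Ss) = SSelect (map_option sdual \<circ> Ss)"
| "sdual SEnd = SEnd"

type_synonym env = "name \<rightharpoonup> ty"

subsection \<open>Terms and configurations\<close>

datatype tm =
    TVar ref
  | Unit
  | TAbs tm
  | App tm tm
  | Pair tm tm
  | TLet tm tm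
  | New
  | Spawn tm
  | Send tm
  | Recv tm
  | Select label tm
  | Case tm "label \<Rightarrow> tm option"
  | TSub tm tm
  | Send' tm tm

primrec abs_tm :: "nat \<Rightarrow> name \<Rightarrow> tm \<Rightarrow> tm" where
  "abs_tm k x (TVar r) = TVar (abs_ref k x r)"
| "abs_tm k x Unit = Unit"
| "abs_tm k x (TAbs M) = TAbs (abs_tm (k + 1) x M)"
| "abs_tm k x (App M N) = App (abs_tm k x M) (abs_tm k x N)"
| "abs_tm k x (Pair M N) = Pair (abs_tm k x M) (abs_tm k x N)"
| "abs_tm k x (TLet M N) = TLet (abs_tm k x M) (abs_tm (k + 2) x N)"
| "abs_tm k x New = New"
| "abs_tm k x (Spawn M) = Spawn (abs_tm k x M)"
| "abs_tm k x (Send M) = Send (abs_tm k x M)"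
| "abs_tm k x (Recv M) = Recv (abs_tm k x M)"
| "abs_tm k x (Select l M) = Select l (abs_tm k x M)"
| "abs_tm k x (Case M Ns) = Case (abs_tm k x M) (map_option (abs_tm k x) \<circ> Ns)"
| "abs_tm k x (TSub M N) = TSub (abs_tm (k + 1) x M) (abs_tm k x N)"
| "abs_tm k x (Send' M N) = Send' (abs_tm k x M) (abs_tm k x N)"

definition Var :: "name \<Rightarrow> tm" where
  "Var x = TVar (Free x)"

definition Lam :: "name \<Rightarrow> tm \<Rightarrow> tm" where
  "Lam x M = TAbs (abs_tm 0 x M)"

definition Split :: "name \<Rightarrow> name \<Rightarrow> tm \<Rightarrow> tm \<Rightarrow> tm" where \<comment> \<open>\<open>let (x, y) = M in N\<close>\<close>
  "Split x y M N = TLet M (abs_tm 0 x (abs_tm 1 y N))"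

definition Sub :: "tm \<Rightarrow> tm \<Rightarrow> name \<Rightarrow> tm" where \<comment> \<open>explicit substitution of \<open>N\<close> for \<open>x\<close> in \<open>M\<close>\<close>
  "Sub M N x = TSub (abs_tm 0 x M) N"

datatype marker = Main | Child

datatype msg = MTerm tm | MLabel label

primrec abs_msg :: "nat \<Rightarrow> name \<Rightarrow> msg \<Rightarrow> msg" where
  "abs_msg k x (MTerm M) = MTerm (abs_tm k x M)"
| "abs_msg k x (MLabel l) = MLabel l"

datatype conf =
    Thread marker tm
  | CPar conf conf
  | CNu "msg list" conf
  | CSub conf tm

text \<open>\<open>CNu\<close> binds two indices in the configuration and one in the messages.\<close>

primrec abs_conf :: "nat \<Rightarrow> name \<Rightarrow> conf \<Rightarrow> conf" where
  "abs_conf k x (Thread \<phi> M) = Thread \<phi> (abs_tm k x M)"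
| "abs_conf k x (CPar C D) = CPar (abs_conf k x C) (abs_conf k x D)"
| "abs_conf k x (CNu ms C) = CNu (map (abs_msg (k + 1) x) ms) (abs_conf (k + 2) x C)"
| "abs_conf k x (CSub C M) = CSub (abs_conf (k + 1) x C) (abs_tm k x M)"

text \<open>
  Besides binding \<open>x\<close> and \<open>y\<close> in \<open>C\<close>, the restriction also binds \<open>y\<close> in the messages: this is what
  rule \<open>ResBuf\<close> requires, which types the messages in \<open>\<Gamma>, y : \<dots>\<close> and discharges \<open>y\<close>.
\<close>

definition Nu :: "name \<Rightarrow> msg list \<Rightarrow> name \<Rightarrow> conf \<Rightarrow> conf" where
  "Nu x ms y C = CNu (map (abs_msg 0 y) ms) (abs_conf 0 x (abs_conf 1 y C))"

definition ConfSub :: "conf \<Rightarrow> tm \<Rightarrow> name \<Rightarrow> conf" where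
  "ConfSub C M x = CSub (abs_conf 0 x C) M"

fun marker_add :: "marker \<Rightarrow> marker \<Rightarrow> marker option" where
  "marker_add Main Child = Some Main"
| "marker_add Child Main = Some Main"
| "marker_add Child Child = Some Child"
| "marker_add Main Main = None"

subsection \<open>Typing derivations\<close>

text \<open>
  The translation is defined on derivations, so these are first-class objects. A tree records the
  applied rules and the variables chosen in them; the judgments \<open>D \<^bold>: \<Gamma> \<turnstile>\<^sub>M M : T\<close> etc. below
  state that \<open>D\<close> is a derivation of the given sequent. A node for \<open>T-Case\<close> also records the
  context of its branches, which the subtrees do not determine if there are no branches.
\<close>

datatype mderiv =
    DVar name
  | DAbs name mderiv
  | DApp mderiv mderiv
  | DUnit
  | DPair mderiv mderiv
  | DSplit name name mderiv mderiv
  | DNew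
  | DSpawn mderiv
  | DEndL name mderiv
  | DEndR name
  | DSend mderiv
  | DRecv mderiv
  | DSelect label mderiv
  | DCase mderiv env "label \<Rightarrow> mderiv option"
  | DSub name mderiv mderiv
  | DSend' mderiv mderiv

datatype bderiv =
    DBuf
  | DBufSend mderiv bderiv
  | DBufSelect label bderiv

datatype cderiv =
    DMain mderiv
  | DChild mderiv
  | DParL cderiv cderiv
  | DParR cderiv cderiv
  | DRes name name bderiv cderiv
  | DResBuf name name bderiv cderiv
  | DConfSub name cderiv mderiv

text \<open>
  Premises such as \<open>x \<notin> dom \<Delta>\<close> in \<open>Sub\<close>, where \<open>x\<close> is bound in the subject of
  the conclusion and \<open>\<Delta>\<close> belongs to that conclusion, express the usual convention that bound
  names differ from those of the context. They exclude no sequent, because subjects are taken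
  up to renaming of bound names.
\<close>

inductive derivM :: "mderiv \<Rightarrow> env \<Rightarrow> tm \<Rightarrow> ty \<Rightarrow> bool" ("_ \<^bold>: _ \<turnstile>\<^sub>M _ : _" [51, 51, 51, 51] 50) where
  Var: "DVar x \<^bold>: [x \<mapsto> T] \<turnstile>\<^sub>M Var x : T"
| Abs: "\<lbrakk>D \<^bold>: \<Gamma>(x \<mapsto> T) \<turnstile>\<^sub>M M : U; x \<notin> dom \<Gamma>\<rbrakk>
    \<Longrightarrow> DAbs x D \<^bold>: \<Gamma> \<turnstile>\<^sub>M Lam x M : Lolli T U"
| App: "\<lbrakk>D \<^bold>: \<Gamma> \<turnstile>\<^sub>M M : Lolli T U; E \<^bold>: \<Delta> \<turnstile>\<^sub>M N : T; \<Gamma> \<bottom> \<Delta>\<rbrakk>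
    \<Longrightarrow> DApp D E \<^bold>: \<Gamma> ++ \<Delta> \<turnstile>\<^sub>M App M N : U"
| Unit: "DUnit \<^bold>: Map.empty \<turnstile>\<^sub>M Unit : One"
| Pair: "\<lbrakk>D \<^bold>: \<Gamma> \<turnstile>\<^sub>M M : T; E \<^bold>: \<Delta> \<turnstile>\<^sub>M N : U; \<Gamma> \<bottom> \<Delta>\<rbrakk>
    \<Longrightarrow> DPair D E \<^bold>: \<Gamma> ++ \<Delta> \<turnstile>\<^sub>M Pair M N : Prod T U"
| Split: "\<lbrakk>D \<^bold>: \<Gamma> \<turnstile>\<^sub>M M : Prod T T'; E \<^bold>: \<Delta>(x \<mapsto> T, y \<mapsto> T') \<turnstile>\<^sub>M N : U;
      x \<noteq> y; x \<notin> dom \<Delta>; y \<notin> dom \<Delta>; \<Gamma> \<bottom> \<Delta>\<rbrakk>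
    \<Longrightarrow> DSplit x y D E \<^bold>: \<Gamma> ++ \<Delta> \<turnstile>\<^sub>M Split x y M N : U"
| New: "DNew \<^bold>: Map.empty \<turnstile>\<^sub>M New : Prod (Session S) (Session (sdual S))"
| Spawn: "D \<^bold>: \<Gamma> \<turnstile>\<^sub>M M : Prod One T
    \<Longrightarrow> DSpawn D \<^bold>: \<Gamma> \<turnstile>\<^sub>M Spawn M : T"
| EndL: "\<lbrakk>D \<^bold>: \<Gamma> \<turnstile>\<^sub>M M : T; x \<notin> dom \<Gamma>\<rbrakk>
    \<Longrightarrow> DEndL x D \<^bold>: \<Gamma>(x \<mapsto> Session SEnd) \<turnstile>\<^sub>M M : T"
| EndR: "DEndR x \<^bold>: Map.empty \<turnstile>\<^sub>M Var x : Session SEnd"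
| Send: "D \<^bold>: \<Gamma> \<turnstile>\<^sub>M M : Prod T (Session (SSend T S))
    \<Longrightarrow> DSend D \<^bold>: \<Gamma> \<turnstile>\<^sub>M Send M : Session S"
| Recv: "D \<^bold>: \<Gamma> \<turnstile>\<^sub>M M : Session (SRecv T S)
    \<Longrightarrow> DRecv D \<^bold>: \<Gamma> \<turnstile>\<^sub>M Recv M : Prod T (Session S)"
| Select: "\<lbrakk>D \<^bold>: \<Gamma> \<turnstile>\<^sub>M M : Session (SSelect Ss); Ss j = Some S\<rbrakk>
    \<Longrightarrow> DSelect j D \<^bold>: \<Gamma> \<turnstile>\<^sub>M Select j M : Session S"
| Case: "\<lbrakk>D \<^bold>: \<Gamma> \<turnstile>\<^sub>M M : Session (SBranch Ss); dom Ns = dom Ss; dom Es = dom Ss;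
      \<And>i S N E. Ss i = Some S \<Longrightarrow> Ns i = Some N \<Longrightarrow> Es i = Some E
        \<Longrightarrow> E \<^bold>: \<Delta> \<turnstile>\<^sub>M N : Lolli (Session S) U;
      finite (dom \<Delta>); \<Gamma> \<bottom> \<Delta>\<rbrakk>
    \<Longrightarrow> DCase D \<Delta> Es \<^bold>: \<Gamma> ++ \<Delta> \<turnstile>\<^sub>M Case M Ns : U"
| Sub: "\<lbrakk>D \<^bold>: \<Gamma>(x \<mapsto> T) \<turnstile>\<^sub>M M : U; E \<^bold>: \<Delta> \<turnstile>\<^sub>M N : T;
      x \<notin> dom \<Gamma>; x \<notin> dom \<Delta>; \<Gamma> \<bottom> \<Delta>\<rbrakk>
    \<Longrightarrow> DSub x D E \<^bold>: \<Gamma> ++ \<Delta> \<turnstile>\<^sub>M Sub M N x : U"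
| Send': "\<lbrakk>D \<^bold>: \<Gamma> \<turnstile>\<^sub>M M : T; E \<^bold>: \<Delta> \<turnstile>\<^sub>M N : Session (SSend T S); \<Gamma> \<bottom> \<Delta>\<rbrakk>
    \<Longrightarrow> DSend' D E \<^bold>: \<Gamma> ++ \<Delta> \<turnstile>\<^sub>M Send' M N : Session S"

inductive derivB :: "bderiv \<Rightarrow> env \<Rightarrow> msg list \<Rightarrow> sess \<Rightarrow> sess \<Rightarrow> bool"
  ("_ \<^bold>: _ \<turnstile>\<^sub>B [_\<rangle> : _ > _" [51, 51, 0, 51, 51] 50) where
  Buf: "DBuf \<^bold>: Map.empty \<turnstile>\<^sub>B [[]\<rangle> : S' > S'"
| BufSend: "\<lbrakk>D \<^bold>: \<Gamma> \<turnstile>\<^sub>M M : T; B \<^bold>: \<Delta> \<turnstile>\<^sub>B [ms\<rangle> : S' > S; \<Gamma> \<bottom> \<Delta>\<rbrakk>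
    \<Longrightarrow> DBufSend D B \<^bold>: \<Gamma> ++ \<Delta> \<turnstile>\<^sub>B [ms @ [MTerm M]\<rangle> : S' > SSend T S"
| BufSelect: "\<lbrakk>B \<^bold>: \<Gamma> \<turnstile>\<^sub>B [ms\<rangle> : S' > S; Ss j = Some S\<rbrakk>
    \<Longrightarrow> DBufSelect j B \<^bold>: \<Gamma> \<turnstile>\<^sub>B [ms @ [MLabel j]\<rangle> : S' > SSelect Ss"

inductive derivC :: "cderiv \<Rightarrow> env \<Rightarrow> marker \<Rightarrow> conf \<Rightarrow> ty \<Rightarrow> bool"
  ("_ \<^bold>: _ \<turnstile>\<^sub>C[_] _ : _" [51, 51, 0, 51, 51] 50) where
  Main: "D \<^bold>: \<Gamma> \<turnstile>\<^sub>M M : T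
    \<Longrightarrow> DMain D \<^bold>: \<Gamma> \<turnstile>\<^sub>C[Main] Thread Main M : T"
| Child: "D \<^bold>: \<Gamma> \<turnstile>\<^sub>M M : One
    \<Longrightarrow> DChild D \<^bold>: \<Gamma> \<turnstile>\<^sub>C[Child] Thread Child M : One"
| ParL: "\<lbrakk>D \<^bold>: \<Gamma> \<turnstile>\<^sub>C[Child] C\<^sub>1 : One; E \<^bold>: \<Delta> \<turnstile>\<^sub>C[\<phi>] C\<^sub>2 : T; marker_add Child \<phi> = Some \<psi>; \<Gamma> \<bottom> \<Delta>\<rbrakk>
    \<Longrightarrow> DParL D E \<^bold>: \<Gamma> ++ \<Delta> \<turnstile>\<^sub>C[\<psi>] CPar C\<^sub>1 C\<^sub>2 : T"
| ParR: "\<lbrakk>D \<^bold>: \<Gamma> \<turnstile>\<^sub>C[\<phi>] C\<^sub>1 : T; E \<^bold>: \<Delta> \<turnstile>\<^sub>C[Child] C\<^sub>2 : One; marker_add \<phi> Child = Some \<psi>; \<Gamma> \<bottom> \<Delta>\<rbrakk>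
    \<Longrightarrow> DParR D E \<^bold>: \<Gamma> ++ \<Delta> \<turnstile>\<^sub>C[\<psi>] CPar C\<^sub>1 C\<^sub>2 : T"
| Res: "\<lbrakk>B \<^bold>: \<Gamma> \<turnstile>\<^sub>B [ms\<rangle> : S' > S; D \<^bold>: \<Delta>(x \<mapsto> Session S', y \<mapsto> Session (sdual S)) \<turnstile>\<^sub>C[\<phi>] C : T;
      x \<noteq> y; x \<notin> dom \<Gamma>; y \<notin> dom \<Gamma>; x \<notin> dom \<Delta>; y \<notin> dom \<Delta>; \<Gamma> \<bottom> \<Delta>\<rbrakk>
    \<Longrightarrow> DRes x y B D \<^bold>: \<Gamma> ++ \<Delta> \<turnstile>\<^sub>C[\<phi>] Nu x ms y C : T"
| ResBuf: "\<lbrakk>B \<^bold>: \<Gamma>(y \<mapsto> Session (sdual S)) \<turnstile>\<^sub>B [ms\<rangle> : S' > S; D \<^bold>: \<Delta>(x \<mapsto> Session S') \<turnstile>\<^sub>C[\<phi>] C : T;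
      x \<noteq> y; x \<notin> dom \<Gamma>; y \<notin> dom \<Gamma>; x \<notin> dom \<Delta>; y \<notin> dom \<Delta>; \<Gamma> \<bottom> \<Delta>\<rbrakk>
    \<Longrightarrow> DResBuf x y B D \<^bold>: \<Gamma> ++ \<Delta> \<turnstile>\<^sub>C[\<phi>] Nu x ms y C : T"
| ConfSub: "\<lbrakk>D \<^bold>: \<Gamma>(x \<mapsto> T) \<turnstile>\<^sub>C[\<phi>] C : U; E \<^bold>: \<Delta> \<turnstile>\<^sub>M M : T;
      x \<notin> dom \<Gamma>; x \<notin> dom \<Delta>; \<Gamma> \<bottom> \<Delta>\<rbrakk>
    \<Longrightarrow> DConfSub x D E \<^bold>: \<Gamma> ++ \<Delta> \<turnstile>\<^sub>C[\<phi>] ConfSub C M x : U"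

text \<open>The domain of the context in the conclusion of a derivation.\<close>

primrec domM :: "mderiv \<Rightarrow> name set" where
  "domM (DVar x) = {x}"
| "domM (DAbs x D) = domM D - {x}"
| "domM (DApp D E) = domM D \<union> domM E"
| "domM DUnit = {}"
| "domM (DPair D E) = domM D \<union> domM E"
| "domM (DSplit x y D E) = domM D \<union> (domM E - {x, y})"
| "domM DNew = {}"
| "domM (DSpawn D) = domM D"
| "domM (DEndL x D) = insert x (domM D)"
| "domM (DEndR x) = {}"
| "domM (DSend D) = domM D"
| "domM (DRecv D) = domM D"
| "domM (DSelect j D) = domM D"
| "domM (DCase D \<Delta> Es) = domM D \<union> dom \<Delta>"
| "domM (DSub x D E) = (domM D - {x}) \<union> domM E"
| "domM (DSend' D E) = domM D \<union> domM E"

primrec domB :: "bderiv \<Rightarrow> name set" where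
  "domB DBuf = {}"
| "domB (DBufSend D B) = domM D \<union> domB B"
| "domB (DBufSelect j B) = domB B"

primrec domC :: "cderiv \<Rightarrow> name set" where
  "domC (DMain D) = domM D"
| "domC (DChild D) = domM D"
| "domC (DParL D E) = domC D \<union> domC E"
| "domC (DParR D E) = domC D \<union> domC E"
| "domC (DRes x y B D) = domB B \<union> (domC D - {x, y})"
| "domC (DResBuf x y B D) = (domB B - {y}) \<union> (domC D - {x})"
| "domC (DConfSub x D E) = (domC D - {x}) \<union> domM E"


section \<open>APCP\<close>

subsection \<open>Processes\<close>

datatype proc =
    POut ref ref ref
  | PIn ref proc
  | PSel ref ref label
  | PBra ref "label \<Rightarrow> proc option"
  | PRes bool proc
  | PPar proc proc  (infixr "\<parallel>" 65)
  | Zero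
  | PFwd ref ref

primrec abs_proc :: "nat \<Rightarrow> name \<Rightarrow> proc \<Rightarrow> proc" where
  "abs_proc k x (POut r s t) = POut (abs_ref k x r) (abs_ref k x s) (abs_ref k x t)"
| "abs_proc k x (PIn r P) = PIn (abs_ref k x r) (abs_proc (k + 2) x P)"
| "abs_proc k x (PSel r s l) = PSel (abs_ref k x r) (abs_ref k x s) l"
| "abs_proc k x (PBra r Ps) = PBra (abs_ref k x r) (map_option (abs_proc (k + 1) x) \<circ> Ps)"
| "abs_proc k x (PRes d P) = PRes d (abs_proc (k + 2) x P)"
| "abs_proc k x (P \<parallel> Q) = abs_proc k x P \<parallel> abs_proc k x Q"
| "abs_proc k x Zero = Zero"
| "abs_proc k x (PFwd r s) = PFwd (abs_ref k x r) (abs_ref k x s)"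

text \<open>In the order of the grammar: \<open>x[y,z]\<close>, \<open>x(y,z).P\<close>, \<open>x[z] \<triangleleft> i\<close>, \<open>x(z) \<triangleright> {i : P\<^sub>i}\<close>,
  \<open>(\<nu>xy)P\<close> without and with decoration, \<open>x \<leftrightarrow> y\<close>.\<close>

definition Out :: "name \<Rightarrow> name \<Rightarrow> name \<Rightarrow> proc" where
  "Out x y z = POut (Free x) (Free y) (Free z)"

definition In :: "name \<Rightarrow> name \<Rightarrow> name \<Rightarrow> proc \<Rightarrow> proc" where
  "In x y z P = PIn (Free x) (abs_proc 0 y (abs_proc 1 z P))"

definition Sel :: "name \<Rightarrow> name \<Rightarrow> label \<Rightarrow> proc" where
  "Sel x z i = PSel (Free x) (Free z) i"

definition Bra :: "name \<Rightarrow> name \<Rightarrow> (label \<Rightarrow> proc option) \<Rightarrow> proc" where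
  "Bra x z Ps = PBra (Free x) (map_option (abs_proc 0 z) \<circ> Ps)"

definition Res :: "name \<Rightarrow> name \<Rightarrow> proc \<Rightarrow> proc" where
  "Res x y P = PRes False (abs_proc 0 x (abs_proc 1 y P))"

definition FRes :: "name \<Rightarrow> name \<Rightarrow> proc \<Rightarrow> proc" where
  "FRes x y P = PRes True (abs_proc 0 x (abs_proc 1 y P))"

definition Fwd :: "name \<Rightarrow> name \<Rightarrow> proc" where
  "Fwd x y = PFwd (Free x) (Free y)"

text \<open>Renaming \<open>P{y/x}\<close> of a free name; it is capture-avoiding since bound names are indices.\<close>

primrec ren_ref :: "name \<Rightarrow> name \<Rightarrow> ref \<Rightarrow> ref" where
  "ren_ref y x (Free u) = Free (if u = x then y else u)"
| "ren_ref y x (Bound i) = Bound i"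

primrec ren :: "proc \<Rightarrow> name \<Rightarrow> name \<Rightarrow> proc" ("_\<lbrace>_'/_\<rbrace>" [1000, 0, 0] 1000) where
  "(POut r s t)\<lbrace>y/x\<rbrace> = POut (ren_ref y x r) (ren_ref y x s) (ren_ref y x t)"
| "(PIn r P)\<lbrace>y/x\<rbrace> = PIn (ren_ref y x r) (P\<lbrace>y/x\<rbrace>)"
| "(PSel r s l)\<lbrace>y/x\<rbrace> = PSel (ren_ref y x r) (ren_ref y x s) l"
| "(PBra r Ps)\<lbrace>y/x\<rbrace> = PBra (ren_ref y x r) (map_option (\<lambda>P. P\<lbrace>y/x\<rbrace>) \<circ> Ps)"
| "(PRes d P)\<lbrace>y/x\<rbrace> = PRes d (P\<lbrace>y/x\<rbrace>)"
| "(P \<parallel> Q)\<lbrace>y/x\<rbrace> = P\<lbrace>y/x\<rbrace> \<parallel> Q\<lbrace>y/x\<rbrace>"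
| "Zero\<lbrace>y/x\<rbrace> = Zero"
| "(PFwd r s)\<lbrace>y/x\<rbrace> = PFwd (ren_ref y x r) (ren_ref y x s)"

subsection \<open>Types and typing without priorities\<close>

datatype pty =
    Tensor pty pty
  | Parr pty pty
  | Plus "label \<Rightarrow> pty option"
  | With "label \<Rightarrow> pty option"
  | Bullet

primrec pdual :: "pty \<Rightarrow> pty" where
  "pdual (Tensor A B) = Parr (pdual A) (pdual B)"
| "pdual (Parr A B) = Tensor (pdual A) (pdual B)"
| "pdual (Plus As) = With (map_option pdual \<circ> As)"
| "pdual (With As) = Plus (map_option pdual \<circ> As)"
| "pdual Bullet = Bullet"

inductive ptyping :: "proc \<Rightarrow> (name \<rightharpoonup> pty) \<Rightarrow> bool" (infix "\<turnstile>\<^sup>*" 50) where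
  Zero: "Zero \<turnstile>\<^sup>* Map.empty"
| Bullet: "\<lbrakk>P \<turnstile>\<^sup>* \<Gamma>; x \<notin> dom \<Gamma>\<rbrakk> \<Longrightarrow> P \<turnstile>\<^sup>* \<Gamma>(x \<mapsto> Bullet)"
| Fwd: "x \<noteq> y \<Longrightarrow> Fwd x y \<turnstile>\<^sup>* [x \<mapsto> pdual A, y \<mapsto> A]"
| Par: "\<lbrakk>P \<turnstile>\<^sup>* \<Gamma>; Q \<turnstile>\<^sup>* \<Delta>; \<Gamma> \<bottom> \<Delta>\<rbrakk> \<Longrightarrow> P \<parallel> Q \<turnstile>\<^sup>* \<Gamma> ++ \<Delta>"
| Res: "\<lbrakk>P \<turnstile>\<^sup>* \<Gamma>(x \<mapsto> A, y \<mapsto> pdual A); x \<noteq> y; x \<notin> dom \<Gamma>; y \<notin> dom \<Gamma>\<rbrakk> \<Longrightarrow> Res x y P \<turnstile>\<^sup>* \<Gamma>"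
| FRes: "\<lbrakk>P \<turnstile>\<^sup>* \<Gamma>(x \<mapsto> A, y \<mapsto> pdual A); x \<noteq> y; x \<notin> dom \<Gamma>; y \<notin> dom \<Gamma>\<rbrakk> \<Longrightarrow> FRes x y P \<turnstile>\<^sup>* \<Gamma>"
| Out: "distinct [x, y, z] \<Longrightarrow> Out x y z \<turnstile>\<^sup>* [x \<mapsto> Tensor A B, y \<mapsto> pdual A, z \<mapsto> pdual B]"
| In: "\<lbrakk>P \<turnstile>\<^sup>* \<Gamma>(y \<mapsto> A, z \<mapsto> B); y \<noteq> z; y \<notin> dom \<Gamma>; z \<notin> dom \<Gamma>; x \<notin> dom \<Gamma>\<rbrakk>
    \<Longrightarrow> In x y z P \<turnstile>\<^sup>* \<Gamma>(x \<mapsto> Parr A B)"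
| Sel: "\<lbrakk>As j = Some A; x \<noteq> z\<rbrakk> \<Longrightarrow> Sel x z j \<turnstile>\<^sup>* [x \<mapsto> Plus As, z \<mapsto> pdual A]"
| Bra: "\<lbrakk>dom Ps = dom As; \<And>i P A. Ps i = Some P \<Longrightarrow> As i = Some A \<Longrightarrow> P \<turnstile>\<^sup>* \<Gamma>(z \<mapsto> A);
      z \<notin> dom \<Gamma>; x \<notin> dom \<Gamma>; finite (dom \<Gamma>)\<rbrakk>
    \<Longrightarrow> Bra x z Ps \<turnstile>\<^sup>* \<Gamma>(x \<mapsto> With As)"


section \<open>The translation\<close>

primrec trT :: "ty \<Rightarrow> pty" and trS :: "sess \<Rightarrow> pty" where
  "trT (Prod T U) = Tensor (Parr (trT T) Bullet) (Parr (trT U) Bullet)"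
| "trT (Lolli T U) = Parr (Tensor (pdual (trT T)) Bullet) (trT U)"
| "trT One = Bullet"
| "trT (Session S) = trS S"
| "trS (SSend T S) = Parr (Tensor (pdual (trT T)) Bullet) (trS S)"
| "trS (SRecv T S) = Tensor (Parr (trT T) Bullet) (trS S)"
| "trS (SSelect Ss) = With (map_option trS \<circ> Ss)"
| "trS (SBranch Ss) = Plus (map_option trS \<circ> Ss)"
| "trS SEnd = Bullet"

definition dual_env :: "env \<Rightarrow> (name \<rightharpoonup> pty)" where
  "dual_env \<Gamma> = map_option (\<lambda>T. pdual (trT T)) \<circ> \<Gamma>"

text \<open>
  The clauses for \<open>T-App\<close> and \<open>T-Pair\<close>, as functions of the translations \<open>p\<close>, \<open>q\<close> of the two
  premises, since \<open>T-Case\<close> and \<open>T-New\<close> refer to them for terms \<open>N\<^sub>i c\<close> and \<open>(x, y)\<close>. The set \<open>X\<close>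
  contains the names of the context.
\<close>

definition tr_app :: "name set \<Rightarrow> (name \<Rightarrow> proc) \<Rightarrow> (name \<Rightarrow> proc) \<Rightarrow> name \<Rightarrow> proc" where
  "tr_app X p q z = (let \<nu> = fresh (insert z X);
      a = \<nu> 0; b = \<nu> 1; c = \<nu> 2; d = \<nu> 3; e = \<nu> 4; f = \<nu> 5
    in Res a b (p a \<parallel> Res c d (Out b c z \<parallel> In d e f (q e))))"

definition tr_pair :: "name set \<Rightarrow> (name \<Rightarrow> proc) \<Rightarrow> (name \<Rightarrow> proc) \<Rightarrow> name \<Rightarrow> proc" where
  "tr_pair X p q z = (let \<nu> = fresh (insert z X);
      a = \<nu> 0; b = \<nu> 1; c = \<nu> 2; d = \<nu> 3; e = \<nu> 4; f = \<nu> 5; g = \<nu> 6; h = \<nu> 7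
    in Res a b (Res c d (Out z a c \<parallel> In b e f (p e) \<parallel> In d g h (q g))))"

text \<open>
  The name \<open>z\<close> at which a derivation is translated may happen to be one of the variables that the
  derivation binds (e.g. \<open>x\<close> in \<open>T-Sub\<close>). Where the scope of such a variable contains \<open>z\<close>,
  the process is built with a fresh name \<open>w\<close> in place of \<open>z\<close>, which is then renamed to \<open>z\<close>. This
  amounts to renaming the bound variable away from \<open>z\<close>; if \<open>z\<close> differs from the bound variables,
  it yields just the formula with \<open>z\<close> for \<open>w\<close>.
\<close>

primrec trM :: "mderiv \<Rightarrow> name \<Rightarrow> proc" where
  "trM (DVar x) = (\<lambda>z. Fwd x z)"
| "trM DUnit = (\<lambda>z. Zero)"
| "trM (DEndR x) = (\<lambda>z. Zero)"
| "trM (DEndL x D) = trM D"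
| "trM (DAbs x D) = (\<lambda>z.
    let \<nu> = fresh (domM D \<union> {x, z}); a = \<nu> 0; b = \<nu> 1; c = \<nu> 2; e = \<nu> 3; f = \<nu> 4
    in In z a b (FRes c x (Res e f (Out a c e) \<parallel> trM D b)))"
| "trM (DApp D E) = tr_app (domM D \<union> domM E) (trM D) (trM E)"
| "trM (DPair D E) = tr_pair (domM D \<union> domM E) (trM D) (trM E)"
| "trM (DSplit x y D E) = (\<lambda>z.
    let \<nu> = fresh (domM D \<union> domM E \<union> {x, y, z});
      a = \<nu> 0; b = \<nu> 1; c = \<nu> 2; d = \<nu> 3; e = \<nu> 4; f = \<nu> 5; g = \<nu> 6; h = \<nu> 7; k = \<nu> 8; l = \<nu> 9;
      w = \<nu> 10
    in (Res a b (trM D a \<parallel>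
          In b c d (FRes e x (FRes f y (Res g h (Out c e g) \<parallel> Res k l (Out d f k) \<parallel> trM E w)))))\<lbrace>z/w\<rbrace>)"
| "trM DNew = (\<lambda>z.
    let \<nu> = fresh {z};
      a = \<nu> 0; b = \<nu> 1; c = \<nu> 2; d = \<nu> 3; e = \<nu> 4; f = \<nu> 5; x = \<nu> 6; y = \<nu> 7
    in Res a b (Res c d (Out a c d) \<parallel>
        In b e f (Res x y (tr_pair {x, y} (\<lambda>z. Fwd x z) (\<lambda>z. Fwd y z) z))))"
| "trM (DSpawn D) = (\<lambda>z.
    let \<nu> = fresh (domM D \<union> {z});
      a = \<nu> 0; b = \<nu> 1; c = \<nu> 2; d = \<nu> 3; e = \<nu> 4; f = \<nu> 5; g = \<nu> 6; h = \<nu> 7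
    in Res a b (trM D a \<parallel> In b c d (Res e f (Out c e f) \<parallel> Res g h (Out d z g))))"
| "trM (DSend D) = (\<lambda>z.
    let \<nu> = fresh (domM D \<union> {z});
      a = \<nu> 0; b = \<nu> 1; c = \<nu> 2; d = \<nu> 3; e = \<nu> 4; f = \<nu> 5; g = \<nu> 6; h = \<nu> 7; k = \<nu> 8; l = \<nu> 9
    in Res a b (trM D a \<parallel>
        In b c d (Res e f (Res g h (Out d e g) \<parallel> Res k l (Out f c k \<parallel> Fwd l z)))))"
| "trM (DRecv D) = (\<lambda>z.
    let \<nu> = fresh (domM D \<union> {z});
      a = \<nu> 0; b = \<nu> 1; c = \<nu> 2; d = \<nu> 3; e = \<nu> 4; f = \<nu> 5; g = \<nu> 6; h = \<nu> 7
    in Res a b (trM D a \<parallel> In b c d (Res e f (Out z c e \<parallel> In f g h (Fwd d g)))))"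
| "trM (DSelect j D) = (\<lambda>z.
    let \<nu> = fresh (domM D \<union> {z}); a = \<nu> 0; b = \<nu> 1; c = \<nu> 2; d = \<nu> 3
    in Res a b (trM D a \<parallel> Res c d (Sel b c j \<parallel> Fwd d z)))"
| "trM (DCase D \<Delta> Es) = (\<lambda>z.
    let \<nu> = fresh (domM D \<union> dom \<Delta> \<union> {z}); a = \<nu> 0; b = \<nu> 1; c = \<nu> 2
    in Res a b (trM D a \<parallel>
        Bra b c (map_option (\<lambda>E. tr_app (dom \<Delta> \<union> {c}) (trM E) (\<lambda>z. Fwd c z) z) \<circ> Es)))"
| "trM (DSub x D E) = (\<lambda>z.
    let \<nu> = fresh (domM D \<union> domM E \<union> {x, z}); a = \<nu> 0; w = \<nu> 1
    in (FRes x a (trM D w \<parallel> trM E a))\<lbrace>z/w\<rbrace>)"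
| "trM (DSend' D E) = (\<lambda>z.
    let \<nu> = fresh (domM D \<union> domM E \<union> {z});
      a = \<nu> 0; b = \<nu> 1; c = \<nu> 2; d = \<nu> 3; e = \<nu> 4; f = \<nu> 5; g = \<nu> 6; h = \<nu> 7
    in Res a b (In a c d (trM D c) \<parallel>
        Res e f (trM E e \<parallel> Res g h (Out f b g \<parallel> Fwd h z))))"

text \<open>
  Buffers are translated relative to a name \<open>x\<close> and a process \<open>P \<turnstile>\<^sup>* \<Lambda>, x : \<dots>\<close>. The set \<open>L\<close> is
  \<open>dom \<Lambda>\<close>; it is a parameter because the introduced names have to avoid it, and \<open>P\<close> need
  not mention all of it.
\<close>

primrec trB :: "bderiv \<Rightarrow> name set \<Rightarrow> name \<Rightarrow> proc \<Rightarrow> proc" where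
  "trB DBuf = (\<lambda>L x P. P)"
| "trB (DBufSend D B) = (\<lambda>L x P.
    let \<nu> = fresh (domM D \<union> domB B \<union> L \<union> {x});
      a = \<nu> 0; b = \<nu> 1; c = \<nu> 2; d = \<nu> 3; e = \<nu> 4; f = \<nu> 5; g = \<nu> 6; h = \<nu> 7
    in Res a b (Res c d
        (Res g h (Fwd x g \<parallel> Out h a c) \<parallel> In b e f (trM D e) \<parallel> trB B L d (P\<lbrace>d/x\<rbrace>))))"
| "trB (DBufSelect j B) = (\<lambda>L x P.
    let \<nu> = fresh (domB B \<union> L \<union> {x}); a = \<nu> 0; b = \<nu> 1; c = \<nu> 2; d = \<nu> 3
    in Res a b (Res c d (Fwd x c \<parallel> Sel d a j) \<parallel> trB B L b (P\<lbrace>b/x\<rbrace>)))"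

primrec trC :: "cderiv \<Rightarrow> name \<Rightarrow> proc" where
  "trC (DMain D) = trM D"
| "trC (DChild D) = trM D"
| "trC (DParL D E) = (\<lambda>z.
    let \<nu> = fresh (domC D \<union> domC E \<union> {z}); a = \<nu> 0; b = \<nu> 1
    in Res a b (trC D a) \<parallel> trC E z)"
| "trC (DParR D E) = (\<lambda>z.
    let \<nu> = fresh (domC D \<union> domC E \<union> {z}); a = \<nu> 0; b = \<nu> 1
    in trC D z \<parallel> Res a b (trC E a))"
| "trC (DRes x y B D) = (\<lambda>z.
    let w = fresh (domB B \<union> domC D \<union> {x, y, z}) 0
    in (Res x y (trB B (domC D - {x} \<union> {w}) x (trC D w)))\<lbrace>z/w\<rbrace>)"
| "trC (DResBuf x y B D) = (\<lambda>z.
    let w = fresh (domB B \<union> domC D \<union> {x, y, z}) 0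
    in (Res x y (trB B (domC D - {x} \<union> {w}) x (trC D w)))\<lbrace>z/w\<rbrace>)"
| "trC (DConfSub x D E) = (\<lambda>z.
    let \<nu> = fresh (domC D \<union> domM E \<union> {x, z}); a = \<nu> 0; w = \<nu> 1
    in (FRes x a (trC D w \<parallel> trM E a))\<lbrace>z/w\<rbrace>)"

end

theory Submission
  imports Defs "HOL-Combinatorics.Transposition"
begin

text \<open>
  By induction on derivations, every rule of CGV becomes a composition of APCP rules in which a
  premise provided at a fresh name \<open>a\<close> is cut against a partner \<open>b\<close> of dual type; this uses that
  translation commutes with duality of session types. Where a clause is built at a fresh name \<open>w\<close>
  and then renamed to \<open>z\<close>, the renaming acts on a typed process as the transposition of \<open>w\<close> and \<open>z\<close>,
  because free names of a typed process lie in its context, and typing is invariant under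
  transpositions.
\<close>

text \<open>
  Contexts that an induction rule instantiates by unification come out eta-expanded, and there
  \<open>fun_upd_apply\<close> would take \<open>\<Gamma>(x \<mapsto> T)\<close> apart before the rules about \<open>dom\<close> apply.
\<close>

declare fun_upd_apply [simp del]

section \<open>Renaming\<close>

text \<open>The generated rule states the hypothesis for \<open>PBra\<close> through membership in
  the range of \<open>Ps\<close> and in \<open>set_option\<close>; here it is stated for each branch
  \<open>Ps i = Some P\<close>.\<close>

lemma proc_induct [case_names POut PIn PSel PBra PRes PPar Zero PFwd]:
  assumes "\<And>r s t. Q (POut r s t)" "\<And>r P. Q P \<Longrightarrow> Q (PIn r P)" "\<And>r s l. Q (PSel r s l)"
    "\<And>r Ps. (\<And>i P. Ps i = Some P \<Longrightarrow> Q P) \<Longrightarrow> Q (PBra r Ps)" "\<And>d P. Q P \<Longrightarrow> Q (PRes d P)"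
    "\<And>P R. Q P \<Longrightarrow> Q R \<Longrightarrow> Q (P \<parallel> R)" "Q Zero" "\<And>r s. Q (PFwd r s)"
  shows "Q P"
proof (induction P)
  case (PBra r Ps)
  show ?case
    by (rule assms(4)) (metis PBra rangeI option.set_intros)
qed (use assms in blast)+

section \<open>Invariance of typing under involutions on names\<close>

primrec rename_ref :: "(name \<Rightarrow> name) \<Rightarrow> ref \<Rightarrow> ref" where
  "rename_ref \<pi> (Free x) = Free (\<pi> x)"
| "rename_ref \<pi> (Bound i) = Bound i"

primrec rename_proc :: "(name \<Rightarrow> name) \<Rightarrow> proc \<Rightarrow> proc" where
  "rename_proc \<pi> (POut r s t) = POut (rename_ref \<pi> r) (rename_ref \<pi> s) (rename_ref \<pi> t)"
| "rename_proc \<pi> (PIn r P) = PIn (rename_ref \<pi> r) (rename_proc \<pi> P)"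
| "rename_proc \<pi> (PSel r s l) = PSel (rename_ref \<pi> r) (rename_ref \<pi> s) l"
| "rename_proc \<pi> (PBra r Ps) = PBra (rename_ref \<pi> r) (map_option (rename_proc \<pi>) \<circ> Ps)"
| "rename_proc \<pi> (PRes d P) = PRes d (rename_proc \<pi> P)"
| "rename_proc \<pi> (P \<parallel> Q) = rename_proc \<pi> P \<parallel> rename_proc \<pi> Q"
| "rename_proc \<pi> Zero = Zero"
| "rename_proc \<pi> (PFwd r s) = PFwd (rename_ref \<pi> r) (rename_ref \<pi> s)"

lemma rename_abs_ref: "inj \<pi> \<Longrightarrow> rename_ref \<pi> (abs_ref k x r) = abs_ref k (\<pi> x) (rename_ref \<pi> r)"
  by (cases r) (auto simp: inj_eq)

text \<open>Injectivity prevents capture: a free \<open>y \<noteq> x\<close> with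
  \<open>\<pi> y = \<pi> x\<close> would be abstracted on the right-hand side only.\<close>

lemma rename_abs_proc:
  assumes "inj \<pi>"
  shows "rename_proc \<pi> (abs_proc k x P) = abs_proc k (\<pi> x) (rename_proc \<pi> P)"
proof (induction P arbitrary: k rule: proc_induct)
  case (PBra r Ps)
  have "map_option (rename_proc \<pi>) (map_option (abs_proc (Suc k) x) (Ps i)) =
      map_option (abs_proc (Suc k) (\<pi> x)) (map_option (rename_proc \<pi>) (Ps i))" for i
    using PBra[of i] by (cases "Ps i") auto
  then show ?case
    by (simp add: rename_abs_ref[OF assms] fun_eq_iff)
qed (simp_all add: rename_abs_ref[OF assms])

lemma comp_involution_upd:
  assumes "\<And>x. \<pi> (\<pi> x) = x"
  shows "\<Gamma>(x := A) \<circ> \<pi> = (\<Gamma> \<circ> \<pi>)(\<pi> x := A)"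
proof
  fix u
  have "\<pi> u = x \<longleftrightarrow> u = \<pi> x"
    using assms by metis
  then show "(\<Gamma>(x := A) \<circ> \<pi>) u = ((\<Gamma> \<circ> \<pi>)(\<pi> x := A)) u"
    by (simp add: fun_upd_apply)
qed

text \<open>The context is pulled back along \<open>\<pi>\<close>. As \<open>\<pi>\<close> is its
  own inverse, this moves the entry of \<open>x\<close> to \<open>\<pi> x\<close>, and no separate
  inverse has to be carried along. Distinctness and freshness conditions survive because
  \<open>\<pi>\<close> is injective, so each rule is reapplied with its bound names mapped as
  well.\<close>

lemma ptyping_rename:
  assumes "P \<turnstile>\<^sup>* \<Gamma>" and inv: "\<And>x. \<pi> (\<pi> x) = x"
  shows "rename_proc \<pi> P \<turnstile>\<^sup>* \<Gamma> \<circ> \<pi>"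
proof -
  have inj: "inj \<pi>"
    by (rule inj_on_inverseI[of _ \<pi>]) (simp add: inv)
  note upd = comp_involution_upd[of \<pi>, OF inv]
  have dom: "\<pi> x \<in> dom (\<Gamma> \<circ> \<pi>) \<longleftrightarrow> x \<in> dom \<Gamma>" for x and \<Gamma> :: "name \<rightharpoonup> pty"
    by (simp add: dom_def inv)
  have empty: "Map.empty \<circ> \<pi> = Map.empty"
    by (simp add: fun_eq_iff)
  have disj: "\<Gamma> \<circ> \<pi> \<bottom> \<Delta> \<circ> \<pi>" if "\<Gamma> \<bottom> \<Delta>" for \<Gamma> \<Delta> :: "name \<rightharpoonup> pty"
    using that by (auto simp: disjoint_ctx_def dom_def)
  have add: "(\<Gamma> ++ \<Delta>) \<circ> \<pi> = (\<Gamma> \<circ> \<pi>) ++ (\<Delta> \<circ> \<pi>)" for \<Gamma> \<Delta> :: "name \<rightharpoonup> pty"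
    by (simp add: fun_eq_iff map_add_def split: option.split)
  have finite: "finite (dom (\<Gamma> \<circ> \<pi>))" if "finite (dom \<Gamma>)" for \<Gamma> :: "name \<rightharpoonup> pty"
  proof -
    have "dom (\<Gamma> \<circ> \<pi>) = \<pi> -` dom \<Gamma>"
      by (auto simp: dom_def)
    then show ?thesis
      using that inj by (simp add: finite_vimageI)
  qed
  from assms(1) show ?thesis
  proof induction
    case Zero
    show ?case unfolding empty by (simp add: ptyping.Zero)
  next
    case (Bullet P \<Gamma> x)
    have "rename_proc \<pi> P \<turnstile>\<^sup>* (\<Gamma> \<circ> \<pi>)(\<pi> x \<mapsto> Bullet)"
      by (rule ptyping.Bullet) (use Bullet in \<open>simp_all add: dom del: comp_apply\<close>)
    then show ?case by (simp only: upd)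
  next
    case (Fwd x y A)
    then show ?case
      unfolding upd empty using ptyping.Fwd[of "\<pi> x" "\<pi> y" A]
      by (simp add: inj_eq[OF inj] Fwd_def del: comp_apply)
  next
    case (Par P \<Gamma> Q \<Delta>)
    show ?case unfolding add rename_proc.simps by (rule ptyping.Par[OF Par.IH disj[OF Par.hyps(3)]])
  next
    case (Res P \<Gamma> x A y)
    then show ?case
      unfolding upd empty using ptyping.Res[of "rename_proc \<pi> P" "\<Gamma> \<circ> \<pi>" "\<pi> x" A "\<pi> y"]
      by (simp add: dom inj_eq[OF inj] Res_def rename_abs_proc[OF inj] del: comp_apply)
  next
    case (FRes P \<Gamma> x A y)
    then show ?case
      unfolding upd empty using ptyping.FRes[of "rename_proc \<pi> P" "\<Gamma> \<circ> \<pi>" "\<pi> x" A "\<pi> y"]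
      by (simp add: dom inj_eq[OF inj] FRes_def rename_abs_proc[OF inj] del: comp_apply)
  next
    case (Out x y z A B)
    then show ?case
      unfolding upd empty using ptyping.Out[of "\<pi> x" "\<pi> y" "\<pi> z" A B]
      by (simp add: inj_eq[OF inj] Out_def del: comp_apply)
  next
    case (In P \<Gamma> y A z B x)
    then show ?case
      unfolding upd empty using ptyping.In[of "rename_proc \<pi> P" "\<Gamma> \<circ> \<pi>" "\<pi> y" A "\<pi> z" B "\<pi> x"]
      by (simp add: dom inj_eq[OF inj] In_def rename_abs_proc[OF inj] del: comp_apply)
  next
    case (Sel As j A x z)
    then show ?case
      unfolding upd empty using ptyping.Sel[of As j A "\<pi> x" "\<pi> z"]
      by (simp add: inj_eq[OF inj] Sel_def del: comp_apply)
  next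
    case (Bra Ps As \<Gamma> z x)
    have "Bra (\<pi> x) (\<pi> z) (map_option (rename_proc \<pi>) \<circ> Ps) \<turnstile>\<^sup>* (\<Gamma> \<circ> \<pi>)(\<pi> x \<mapsto> With As)"
    proof (rule ptyping.Bra)
      show "dom (map_option (rename_proc \<pi>) \<circ> Ps) = dom As"
        using Bra.hyps(1) by (auto simp: dom_def)
      show "\<And>i P A. (map_option (rename_proc \<pi>) \<circ> Ps) i = Some P \<Longrightarrow> As i = Some A \<Longrightarrow>
          P \<turnstile>\<^sup>* (\<Gamma> \<circ> \<pi>)(\<pi> z \<mapsto> A)"
        using Bra.IH by (auto simp: upd)
    qed (use Bra in \<open>auto simp: dom finite simp del: comp_apply\<close>)
    moreover have "rename_proc \<pi> (Bra x z Ps) = Bra (\<pi> x) (\<pi> z) (map_option (rename_proc \<pi>) \<circ> Ps)"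
      by (simp add: Bra_def fun_eq_iff option.map_comp rename_abs_proc[OF inj] comp_def)
    ultimately show ?case by (simp only: upd)
  qed
qed

section \<open>Free names of typed processes\<close>

lemma abs_ref_absorb: "abs_ref k x (abs_ref j x r) = abs_ref j x r"
  by (cases r) auto

text \<open>The inner abstraction leaves no free \<open>x\<close> for the outer one, so the two
  indices need not be related.\<close>

lemma abs_proc_absorb: "abs_proc k x (abs_proc j x P) = abs_proc j x P"
proof (induction P arbitrary: k j rule: proc_induct)
  case (PBra r Ps)
  have "map_option (abs_proc (Suc k) x) (map_option (abs_proc (Suc j) x) (Ps i)) =
      map_option (abs_proc (Suc j) x) (Ps i)" for i
    using PBra[of i] by (cases "Ps i") auto
  then show ?case by (simp add: fun_eq_iff abs_ref_absorb)
qed (simp_all add: abs_ref_absorb)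

lemma abs_ref_commute: "x \<noteq> y \<Longrightarrow> abs_ref k x (abs_ref j y r) = abs_ref j y (abs_ref k x r)"
  by (cases r) auto

lemma abs_proc_commute:
  assumes "x \<noteq> y"
  shows "abs_proc k x (abs_proc j y P) = abs_proc j y (abs_proc k x P)"
proof (induction P arbitrary: k j rule: proc_induct)
  case (PBra r Ps)
  have "map_option (abs_proc (Suc k) x) (map_option (abs_proc (Suc j) y) (Ps i)) =
      map_option (abs_proc (Suc j) y) (map_option (abs_proc (Suc k) x) (Ps i))" for i
    using PBra[of i] by (cases "Ps i") auto
  then show ?case by (simp add: fun_eq_iff abs_ref_commute[OF assms])
qed (simp_all add: abs_ref_commute[OF assms])

text \<open>That \<open>u\<close> does not occur in \<open>P\<close> is expressed by saying that abstracting \<open>u\<close> leaves \<open>P\<close> unchanged.\<close>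

lemma ptyping_not_free: "\<lbrakk>P \<turnstile>\<^sup>* \<Gamma>; u \<notin> dom \<Gamma>\<rbrakk> \<Longrightarrow> abs_proc k u P = P"
proof (induction arbitrary: k rule: ptyping.induct)
  case (Res P \<Gamma> x A y)
  \<comment> \<open>\<open>u\<close> is only known to lie outside the context of the conclusion, so
    it may be one of the names bound here. In that case its abstraction is absorbed by the binder;
    otherwise it commutes with both abstractions and reaches \<open>P\<close>, where the induction
    hypothesis applies.\<close>
  have "abs_proc k u P = P" if "u \<noteq> x" "u \<noteq> y" for k
    by (rule Res.IH) (use that Res.prems in auto)
  with Res.hyps show ?case
    by (cases "u = x"; cases "u = y")
      (simp_all add: Res_def abs_proc_absorb abs_proc_commute[of u x] abs_proc_commute[of u y]
        abs_proc_commute[of y x])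
next
  case (FRes P \<Gamma> x A y)
  have "abs_proc k u P = P" if "u \<noteq> x" "u \<noteq> y" for k
    by (rule FRes.IH) (use that FRes.prems in auto)
  with FRes.hyps show ?case
    by (cases "u = x"; cases "u = y")
      (simp_all add: FRes_def abs_proc_absorb abs_proc_commute[of u x] abs_proc_commute[of u y]
        abs_proc_commute[of y x])
next
  case (In P \<Gamma> y A z B x)
  have "abs_proc k u P = P" if "u \<noteq> y" "u \<noteq> z" for k
    by (rule In.IH) (use that In.prems in \<open>auto split: if_splits\<close>)
  with In.hyps In.prems show ?case
    by (cases "u = y"; cases "u = z")
      (simp_all add: In_def abs_proc_absorb abs_proc_commute[of u y] abs_proc_commute[of u z]
        abs_proc_commute[of z y] domIff split: if_splits)
next
  case (Bra Ps As \<Gamma> z x)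
  have "map_option (abs_proc (Suc k) u) (map_option (abs_proc 0 z) (Ps i)) =
      map_option (abs_proc 0 z) (Ps i)" for i
  proof (cases "Ps i")
    case (Some P)
    then obtain A where "As i = Some A"
      using Bra.hyps(1) by blast
    with Some Bra.IH[of i P A] Bra.prems Bra.hyps show ?thesis
      by (cases "u = z") (simp_all add: abs_proc_absorb abs_proc_commute[of u z])
  qed simp
  then show ?case
    using Bra.prems by (simp add: Bra_def fun_eq_iff)
qed (auto simp: Fwd_def Out_def Sel_def)

section \<open>Renaming as a transposition\<close>

lemma ren_ref_eq_transpose: "abs_ref k y r = r \<Longrightarrow> ren_ref y x r = rename_ref (transpose x y) r"
  by (cases r) (auto simp: transpose_def)

text \<open>For \<open>x \<noteq> y\<close> the replacement and the transposition differ only at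
  \<open>y\<close>, and the premise says that \<open>y\<close> is not free in \<open>P\<close>. The
  index \<open>k\<close> is arbitrary because it grows under binders.\<close>

lemma ren_eq_transpose: "abs_proc k y P = P \<Longrightarrow> P\<lbrace>y/x\<rbrace> = rename_proc (transpose x y) P"
proof (induction P arbitrary: k rule: proc_induct)
  case (PBra r Ps)
  have "map_option (\<lambda>P. P\<lbrace>y/x\<rbrace>) (Ps i) = map_option (rename_proc (transpose x y)) (Ps i)" for i
  proof (cases "Ps i")
    case (Some P)
    moreover have "map_option (abs_proc (Suc k) y) (Ps i) = Ps i"
      using PBra(2) by (simp add: fun_eq_iff)
    ultimately show ?thesis
      using PBra(1)[of i P "Suc k"] by simp
  qed simp
  with PBra(2) show ?case
    by (auto simp: fun_eq_iff intro: ren_ref_eq_transpose)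
qed (auto intro: ren_ref_eq_transpose)

lemma ren_ref_self: "ren_ref w w r = r"
  by (cases r) auto

lemma ren_self: "P\<lbrace>w/w\<rbrace> = P"
proof (induction P rule: proc_induct)
  case (PBra r Ps)
  have "map_option (\<lambda>P. P\<lbrace>w/w\<rbrace>) (Ps i) = Ps i" for i
    using PBra[of i] by (cases "Ps i") auto
  then show ?case by (simp add: fun_eq_iff ren_ref_self)
qed (simp_all add: ren_ref_self)

text \<open>\<open>z\<close> is outside the context unless \<open>z = w\<close>, hence not free in
  \<open>P\<close>, and the renaming is a transposition. Nothing requires \<open>w\<close> to occur
  in \<open>P\<close>: if it was added with type \<open>Bullet\<close>, the process stays the same
  and only the context changes.\<close>

lemma ptyping_ren:
  assumes "P \<turnstile>\<^sup>* \<Gamma>(w \<mapsto> A)" "w \<notin> dom \<Gamma>" "z \<notin> dom \<Gamma>"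
  shows "P\<lbrace>z/w\<rbrace> \<turnstile>\<^sup>* \<Gamma>(z \<mapsto> A)"
proof (cases "z = w")
  case True
  with assms(1) show ?thesis by (simp add: ren_self)
next
  case False
  \<comment> \<open>Neither name is in \<open>dom \<Gamma>\<close>, so the transposition moves only
    the added entry.\<close>
  have "\<Gamma>(w \<mapsto> A) \<circ> transpose w z = \<Gamma>(z \<mapsto> A)"
    using assms(2,3) by (auto simp: fun_eq_iff fun_upd_apply transpose_def domIff)
  moreover have "P\<lbrace>z/w\<rbrace> = rename_proc (transpose w z) P"
    using False assms by (intro ren_eq_transpose ptyping_not_free[OF assms(1)]) simp
  ultimately show ?thesis
    using ptyping_rename[OF assms(1), of "transpose w z"] by simp
qed

section \<open>Types, environments and fresh names\<close>

lemma pdual_pdual [simp]: "pdual (pdual A) = A"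
proof (induction A)
  case (Plus As)
  have "pdual (pdual A) = A" if "As i = Some A" for i A
    by (metis Plus that rangeI option.set_intros)
  then have "map_option (pdual \<circ> pdual) (As i) = As i" for i
    by (cases "As i") auto
  then show ?case by (simp add: fun_eq_iff option.map_comp)
next
  case (With As)
  have "pdual (pdual A) = A" if "As i = Some A" for i A
    by (metis With that rangeI option.set_intros)
  then have "map_option (pdual \<circ> pdual) (As i) = As i" for i
    by (cases "As i") auto
  then show ?case by (simp add: fun_eq_iff option.map_comp)
qed simp_all

text \<open>Dualizing a session leaves its payload types alone, so nothing has to be shown about
  \<open>ty\<close> and the predicate for that sort is trivial. On the process side the payload is
  dualized twice, which \<open>pdual_pdual\<close> cancels.\<close>

lemma trS_sdual [simp]: "trS (sdual S) = pdual (trS S)"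
proof (induction S rule: sess.induct[of "\<lambda>_. True"])
  case (SSelect Ss)
  have "trS (sdual S) = pdual (trS S)" if "Ss i = Some S" for i S
    by (metis SSelect that rangeI option.set_intros)
  then have "map_option (trS \<circ> sdual) (Ss i) = map_option (pdual \<circ> trS) (Ss i)" for i
    by (cases "Ss i") auto
  then show ?case by (simp add: fun_eq_iff option.map_comp)
next
  case (SBranch Ss)
  have "trS (sdual S) = pdual (trS S)" if "Ss i = Some S" for i S
    by (metis SBranch that rangeI option.set_intros)
  then have "map_option (trS \<circ> sdual) (Ss i) = map_option (pdual \<circ> trS) (Ss i)" for i
    by (cases "Ss i") auto
  then show ?case by (simp add: fun_eq_iff option.map_comp)
qed simp_all

lemma dom_dual_env [simp]: "dom (dual_env \<Gamma>) = dom \<Gamma>"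
  by (auto simp: dual_env_def dom_def)

lemma notin_dom_None: "x \<notin> dom m \<Longrightarrow> m x = None"
  by (simp add: domIff)

lemma dual_env_None [simp]: "x \<notin> dom \<Gamma> \<Longrightarrow> dual_env \<Gamma> x = None"
  by (simp add: dual_env_def domIff)

lemma dual_env_empty [simp]: "dual_env Map.empty = Map.empty"
  by (simp add: dual_env_def fun_eq_iff)

lemma dual_env_upd [simp]: "dual_env (\<Gamma>(x \<mapsto> T)) = (dual_env \<Gamma>)(x \<mapsto> pdual (trT T))"
  by (simp add: dual_env_def fun_eq_iff fun_upd_apply)

lemma dual_env_add [simp]: "dual_env (\<Gamma> ++ \<Delta>) = dual_env \<Gamma> ++ dual_env \<Delta>"
  by (simp add: dual_env_def fun_eq_iff map_add_def split: option.split)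

lemma disjoint_dual_env [simp]: "dual_env \<Gamma> \<bottom> dual_env \<Delta> \<longleftrightarrow> \<Gamma> \<bottom> \<Delta>"
  by (simp add: disjoint_ctx_def)

section \<open>Domains of contexts and the supply of fresh names\<close>

text \<open>The translation chooses names outside \<open>domM D\<close>, computed from the tree
  alone; this connects that set with the context of the sequent. Finiteness is what makes
  \<open>fresh\<close> meaningful.\<close>

lemma domM_eq: "D \<^bold>: \<Gamma> \<turnstile>\<^sub>M M : T \<Longrightarrow> domM D = dom \<Gamma> \<and> finite (dom \<Gamma>)"
  by (induction rule: derivM.induct) auto

lemma domB_eq: "B \<^bold>: \<Gamma> \<turnstile>\<^sub>B [ms\<rangle> : S' > S \<Longrightarrow> domB B = dom \<Gamma> \<and> finite (dom \<Gamma>)"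
  by (induction rule: derivB.induct) (auto dest: domM_eq)

lemma domC_eq: "D \<^bold>: \<Gamma> \<turnstile>\<^sub>C[\<phi>] C : T \<Longrightarrow> domC D = dom \<Gamma> \<and> finite (dom \<Gamma>)"
  by (induction rule: derivC.induct) (auto dest!: domM_eq domB_eq)

text \<open>Needed for buffers: there \<open>\<Lambda>\<close> comes from an arbitrary typed
  process, not from a CGV derivation.\<close>

lemma ptyping_finite: "P \<turnstile>\<^sup>* \<Gamma> \<Longrightarrow> finite (dom \<Gamma>)"
  by (induction rule: ptyping.induct) auto

text \<open>The complement of a finite set of naturals is infinite, so the choice in
  \<open>fresh_def\<close> has a witness. One injective sequence yields all names of a clause, and
  their distinctness reduces to that of numerals.\<close>

lemma fresh:
  assumes "finite A"
  shows "inj (fresh A)" and "fresh A i \<notin> A"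
proof -
  have "\<exists>\<nu> :: nat \<Rightarrow> name. inj \<nu> \<and> range \<nu> \<subseteq> - A"
    using assms by (intro infinite_countable_subset) (simp add: Compl_eq_Diff_UNIV Diff_infinite_finite)
  then have "\<exists>\<nu> :: nat \<Rightarrow> name. inj \<nu> \<and> range \<nu> \<inter> A = {}"
    by blast
  then have "inj (fresh A) \<and> range (fresh A) \<inter> A = {}"
    unfolding fresh_def by (rule someI_ex)
  then show "inj (fresh A)" and "fresh A i \<notin> A"
    by auto
qed

section \<open>Derived typing rules\<close>

text \<open>Equal contexts can be written with updates and sums in different orders. This rule lets
  a typing rule be applied in the form that unifies and leaves the equality of maps as a separate
  goal.\<close>

lemma ptyping_cong: "\<lbrakk>P \<turnstile>\<^sup>* \<Gamma>; \<Gamma> = \<Delta>\<rbrakk> \<Longrightarrow> P \<turnstile>\<^sup>* \<Delta>"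
  by simp

lemmas ctx_simps = fun_eq_iff fun_upd_apply map_add_def disjoint_ctx_def

text \<open>Parallel composition followed by restriction of the dual pair. Duality is a separate
  equation, so \<open>B\<close> may be given in any form equal to \<open>pdual A\<close>, in
  particular with double duals cancelled.\<close>

lemma ptyping_cut:
  assumes "P \<turnstile>\<^sup>* \<Gamma>(a \<mapsto> A)" "Q \<turnstile>\<^sup>* \<Delta>(b \<mapsto> B)" "B = pdual A" "a \<noteq> b"
    "a \<notin> dom \<Gamma>" "b \<notin> dom \<Gamma>" "a \<notin> dom \<Delta>" "b \<notin> dom \<Delta>" "\<Gamma> \<bottom> \<Delta>"
  shows "Res a b (P \<parallel> Q) \<turnstile>\<^sup>* \<Gamma> ++ \<Delta>" and "FRes a b (P \<parallel> Q) \<turnstile>\<^sup>* \<Gamma> ++ \<Delta>"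
proof -
  have "P \<parallel> Q \<turnstile>\<^sup>* \<Gamma>(a \<mapsto> A) ++ \<Delta>(b \<mapsto> B)"
    using assms by (intro ptyping.Par) (auto simp: disjoint_ctx_def)
  also have "\<Gamma>(a \<mapsto> A) ++ \<Delta>(b \<mapsto> B) = (\<Gamma> ++ \<Delta>)(a \<mapsto> A, b \<mapsto> pdual A)"
    using assms by (simp add: map_add_upd_left)
  finally have *: "P \<parallel> Q \<turnstile>\<^sup>* (\<Gamma> ++ \<Delta>)(a \<mapsto> A, b \<mapsto> pdual A)" .
  show "Res a b (P \<parallel> Q) \<turnstile>\<^sup>* \<Gamma> ++ \<Delta>"
    by (rule ptyping.Res[OF *]) (use assms in auto)
  show "FRes a b (P \<parallel> Q) \<turnstile>\<^sup>* \<Gamma> ++ \<Delta>"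
    by (rule ptyping.FRes[OF *]) (use assms in auto)
qed

text \<open>The partner \<open>b\<close> is added by weakening, and \<open>Bullet\<close> is its own
  dual. This discards padding names and also closes a child thread, whose type \<open>One\<close>
  translates to \<open>Bullet\<close>.\<close>

lemma ptyping_Res_Bullet:
  assumes "P \<turnstile>\<^sup>* \<Gamma>(a \<mapsto> Bullet)" "a \<noteq> b" "a \<notin> dom \<Gamma>" "b \<notin> dom \<Gamma>"
  shows "Res a b P \<turnstile>\<^sup>* \<Gamma>"
proof -
  have "P \<turnstile>\<^sup>* \<Gamma>(a \<mapsto> Bullet, b \<mapsto> Bullet)"
    using assms by (intro ptyping.Bullet[of P "\<Gamma>(a \<mapsto> Bullet)"]) auto
  then show ?thesis
    using assms ptyping.Res[of P \<Gamma> a Bullet b] by simp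
qed

text \<open>The release signal for a suspended subterm: \<open>c\<close> is the name at which it is
  to run, \<open>e\<close> is padding.\<close>

lemma ptyping_Out_Bullet:
  assumes "distinct [a, c, e, f]"
  shows "Res e f (Out a c e) \<turnstile>\<^sup>* [a \<mapsto> Tensor A Bullet, c \<mapsto> pdual A]"
  using assms ptyping.Out[of a c e A Bullet] by (intro ptyping_Res_Bullet) simp_all

text \<open>The guard that suspends a subterm: \<open>y\<close> is where it will run, and
  \<open>z\<close> enters the context by weakening.\<close>

lemma ptyping_In_Bullet:
  assumes "P \<turnstile>\<^sup>* \<Gamma>(y \<mapsto> A)" "y \<noteq> z" "x \<notin> dom \<Gamma>" "y \<notin> dom \<Gamma>" "z \<notin> dom \<Gamma>"
  shows "In x y z P \<turnstile>\<^sup>* \<Gamma>(x \<mapsto> Parr A Bullet)"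
  using assms by (intro ptyping.In ptyping.Bullet) simp_all

text \<open>The actual sending step, shared by \<open>Send\<close> and \<open>Send'\<close>:
  \<open>b\<close> is the payload, and the continuation of the session is forwarded to
  \<open>z\<close>. With \<open>A = Parr (trT T) Bullet\<close> and \<open>B = trS S\<close>, the
  type of \<open>f\<close> is dual to \<open>trS (SSend T S)\<close>.\<close>

lemma ptyping_Out_Fwd:
  assumes "distinct [f, b, z, g, h]"
  shows "Res g h (Out f b g \<parallel> Fwd h z) \<turnstile>\<^sup>* [b \<mapsto> pdual A, z \<mapsto> B, f \<mapsto> Tensor A (pdual B)]"
proof -
  have out: "Out f b g \<turnstile>\<^sup>* [f \<mapsto> Tensor A (pdual B), b \<mapsto> pdual A](g \<mapsto> B)"
    using ptyping.Out[of f b g A "pdual B"] assms by simp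
  have fwd: "Fwd h z \<turnstile>\<^sup>* [z \<mapsto> B](h \<mapsto> pdual B)"
    by (rule ptyping_cong[OF ptyping.Fwd[of h z B]]) (use assms in \<open>auto simp: ctx_simps\<close>)
  show ?thesis
    by (rule ptyping_cong[OF ptyping_cut(1)[OF out fwd]]) (use assms in \<open>auto simp: ctx_simps\<close>)
qed

section \<open>Application and pairing\<close>

text \<open>The functions \<open>p\<close> and \<open>q\<close> need not be translations of
  derivations: in \<open>Case\<close> the argument is a bare forwarder. The type of
  \<open>p a\<close> is the shape of a translated \<open>Lolli\<close>, and \<open>z\<close> is
  handed over as the continuation of the output, so the result arrives there directly.\<close>

lemma ptyping_tr_app:
  assumes p: "\<And>a. a \<notin> dom \<Gamma> \<Longrightarrow> p a \<turnstile>\<^sup>* \<Gamma>(a \<mapsto> Parr (Tensor (pdual A) Bullet) B)"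
    and q: "\<And>e. e \<notin> dom \<Delta> \<Longrightarrow> q e \<turnstile>\<^sup>* \<Delta>(e \<mapsto> A)"
    and "finite X" "dom \<Gamma> \<subseteq> X" "dom \<Delta> \<subseteq> X" "\<Gamma> \<bottom> \<Delta>" "z \<notin> dom \<Gamma>" "z \<notin> dom \<Delta>"
  shows "tr_app X p q z \<turnstile>\<^sup>* (\<Gamma> ++ \<Delta>)(z \<mapsto> B)"
proof -
  define \<nu> where "\<nu> = fresh (insert z X)"
  note \<nu> = fresh[of "insert z X", folded \<nu>_def]
  have [simp]: "\<nu> i \<notin> dom \<Gamma>" "\<nu> i \<notin> dom \<Delta>" "\<nu> i \<noteq> z" "z \<noteq> \<nu> i" "\<nu> i = \<nu> j \<longleftrightarrow> i = j" for i j
    using \<nu>(1) \<nu>(2)[of i] assms by (auto simp: inj_eq)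
  then have [simp]: "\<Gamma> (\<nu> i) = None" "\<Delta> (\<nu> i) = None" for i
    by (auto simp: domIff)
  have out: "Out (\<nu> 1) (\<nu> 2) z \<turnstile>\<^sup>*
      [\<nu> 1 \<mapsto> Tensor (Parr A Bullet) (pdual B), z \<mapsto> B](\<nu> 2 \<mapsto> Tensor (pdual A) Bullet)"
    by (rule ptyping_cong[OF ptyping.Out[of _ _ _ "Parr A Bullet" "pdual B"]]) (auto simp: ctx_simps)
  have inp: "In (\<nu> 3) (\<nu> 4) (\<nu> 5) (q (\<nu> 4)) \<turnstile>\<^sup>* \<Delta>(\<nu> 3 \<mapsto> Parr A Bullet)"
    by (rule ptyping_In_Bullet[OF q]) auto
  have arg: "Res (\<nu> 2) (\<nu> 3) (Out (\<nu> 1) (\<nu> 2) z \<parallel> In (\<nu> 3) (\<nu> 4) (\<nu> 5) (q (\<nu> 4))) \<turnstile>\<^sup>*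
      \<Delta>(z \<mapsto> B, \<nu> 1 \<mapsto> Tensor (Parr A Bullet) (pdual B))"
    by (rule ptyping_cong[OF ptyping_cut(1)[OF out inp]])
      (use assms in \<open>auto simp: ctx_simps split: option.split\<close>)
  have "Res (\<nu> 0) (\<nu> 1) (p (\<nu> 0) \<parallel>
      Res (\<nu> 2) (\<nu> 3) (Out (\<nu> 1) (\<nu> 2) z \<parallel> In (\<nu> 3) (\<nu> 4) (\<nu> 5) (q (\<nu> 4)))) \<turnstile>\<^sup>* \<Gamma> ++ \<Delta>(z \<mapsto> B)"
    by (rule ptyping_cut(1)[OF p arg]) (use assms in \<open>auto simp: disjoint_ctx_def\<close>)
  then show ?thesis
    by (simp add: tr_app_def Let_def flip: \<nu>_def)
qed

lemma ptyping_tr_pair: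
  assumes p: "\<And>e. e \<notin> dom \<Gamma> \<Longrightarrow> p e \<turnstile>\<^sup>* \<Gamma>(e \<mapsto> A)"
    and q: "\<And>e. e \<notin> dom \<Delta> \<Longrightarrow> q e \<turnstile>\<^sup>* \<Delta>(e \<mapsto> B)"
    and "finite X" "dom \<Gamma> \<subseteq> X" "dom \<Delta> \<subseteq> X" "\<Gamma> \<bottom> \<Delta>" "z \<notin> dom \<Gamma>" "z \<notin> dom \<Delta>"
  shows "tr_pair X p q z \<turnstile>\<^sup>* (\<Gamma> ++ \<Delta>)(z \<mapsto> Tensor (Parr A Bullet) (Parr B Bullet))"
proof -
  define \<nu> where "\<nu> = fresh (insert z X)"
  note \<nu> = fresh[of "insert z X", folded \<nu>_def]
  have [simp]: "\<nu> i \<notin> dom \<Gamma>" "\<nu> i \<notin> dom \<Delta>" "\<nu> i \<noteq> z" "z \<noteq> \<nu> i" "\<nu> i = \<nu> j \<longleftrightarrow> i = j" for i j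
    using \<nu>(1) \<nu>(2)[of i] assms by (auto simp: inj_eq)
  then have [simp]: "\<Gamma> (\<nu> i) = None" "\<Delta> (\<nu> i) = None" for i
    by (auto simp: domIff)
  let ?C = "Tensor (Parr A Bullet) (Parr B Bullet)"
  have out: "Out z (\<nu> 0) (\<nu> 2) \<turnstile>\<^sup>*
      [z \<mapsto> ?C, \<nu> 0 \<mapsto> pdual (Parr A Bullet)](\<nu> 2 \<mapsto> pdual (Parr B Bullet))"
    by (rule ptyping.Out) auto
  have inp: "In (\<nu> 1) (\<nu> 4) (\<nu> 5) (p (\<nu> 4)) \<turnstile>\<^sup>* \<Gamma>(\<nu> 1 \<mapsto> Parr A Bullet)"
    by (rule ptyping_In_Bullet[OF p]) auto
  have inq: "In (\<nu> 3) (\<nu> 6) (\<nu> 7) (q (\<nu> 6)) \<turnstile>\<^sup>* \<Delta>(\<nu> 3 \<mapsto> Parr B Bullet)"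
    by (rule ptyping_In_Bullet[OF q]) auto
  have par: "In (\<nu> 1) (\<nu> 4) (\<nu> 5) (p (\<nu> 4)) \<parallel> In (\<nu> 3) (\<nu> 6) (\<nu> 7) (q (\<nu> 6)) \<turnstile>\<^sup>*
      ((\<Gamma> ++ \<Delta>)(\<nu> 1 \<mapsto> Parr A Bullet))(\<nu> 3 \<mapsto> Parr B Bullet)"
    by (rule ptyping_cong[OF ptyping.Par[OF inp inq]])
      (use assms in \<open>auto simp: disjoint_ctx_def map_add_upd_left\<close>)
  \<comment> \<open>After the cut on the second component, both ends of the first pair lie in one
    context, so the outer restriction is \<open>ptyping.Res\<close> and not a cut. The double dual
    is kept to match that rule.\<close>
  have "Res (\<nu> 2) (\<nu> 3) (Out z (\<nu> 0) (\<nu> 2) \<parallel> In (\<nu> 1) (\<nu> 4) (\<nu> 5) (p (\<nu> 4)) \<parallel>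
      In (\<nu> 3) (\<nu> 6) (\<nu> 7) (q (\<nu> 6))) \<turnstile>\<^sup>*
      ((\<Gamma> ++ \<Delta>)(z \<mapsto> ?C))(\<nu> 0 \<mapsto> pdual (Parr A Bullet), \<nu> 1 \<mapsto> pdual (pdual (Parr A Bullet)))"
    by (rule ptyping_cong[OF ptyping_cut(1)[OF out par]])
      (use assms in \<open>auto simp: ctx_simps split: option.split\<close>)
  from ptyping.Res[OF this] assms show ?thesis
    by (simp add: tr_pair_def Let_def flip: \<nu>_def)
qed

section \<open>The translation\<close>

lemma ptyping_trM:
  "\<lbrakk>D \<^bold>: \<Gamma> \<turnstile>\<^sub>M M : T; z \<notin> dom \<Gamma>\<rbrakk> \<Longrightarrow> trM D z \<turnstile>\<^sup>* (dual_env \<Gamma>)(z \<mapsto> trT T)"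
proof (induction arbitrary: z rule: derivM.induct)
  case (Var x T)
  then show ?case
    using ptyping.Fwd[of x z "trT T"] by auto
next
  case (Abs D \<Gamma> x T M U)
  define \<nu> where "\<nu> = fresh (domM D \<union> {x, z})"
  have dom: "domM D = insert x (dom \<Gamma>)" and fin: "finite (dom \<Gamma>)"
    using domM_eq[OF Abs.hyps(1)] by auto
  note \<nu> = fresh[of "domM D \<union> {x, z}", folded \<nu>_def, unfolded dom]
  have [simp]: "\<nu> i \<notin> dom \<Gamma>" "\<nu> i \<noteq> x" "x \<noteq> \<nu> i" "\<nu> i \<noteq> z" "z \<noteq> \<nu> i" "\<nu> i = \<nu> j \<longleftrightarrow> i = j" for i j
    using \<nu>(1) \<nu>(2)[of i] fin by (auto simp: inj_eq)
  note [simp] = Abs.hyps(2)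
  have out: "Res (\<nu> 3) (\<nu> 4) (Out (\<nu> 0) (\<nu> 2) (\<nu> 3)) \<turnstile>\<^sup>*
      [\<nu> 0 \<mapsto> Tensor (pdual (trT T)) Bullet](\<nu> 2 \<mapsto> trT T)"
    using ptyping_Out_Bullet[of "\<nu> 0" "\<nu> 2" "\<nu> 3" "\<nu> 4" "pdual (trT T)"] by simp
  \<comment> \<open>The entry of \<open>x\<close> is moved to the end, where the cut expects
    it.\<close>
  have body: "trM D (\<nu> 1) \<turnstile>\<^sup>* (dual_env \<Gamma>)(\<nu> 1 \<mapsto> trT U, x \<mapsto> pdual (trT T))"
    by (rule ptyping_cong[OF Abs.IH[of "\<nu> 1"]]) (simp_all add: fun_upd_twist)
  have "FRes (\<nu> 2) x (Res (\<nu> 3) (\<nu> 4) (Out (\<nu> 0) (\<nu> 2) (\<nu> 3)) \<parallel> trM D (\<nu> 1)) \<turnstile>\<^sup>*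
      (dual_env \<Gamma>)(\<nu> 0 \<mapsto> Tensor (pdual (trT T)) Bullet, \<nu> 1 \<mapsto> trT U)"
    by (rule ptyping_cong[OF ptyping_cut(2)[OF out body]])
      (auto simp: ctx_simps split: option.split)
  from ptyping.In[OF this, of z] Abs.prems show ?case
    unfolding trM.simps Let_def \<nu>_def[symmetric] by simp
next
  case (App D \<Gamma> M T U E \<Delta> N)
  have "tr_app (domM D \<union> domM E) (trM D) (trM E) z \<turnstile>\<^sup>* (dual_env \<Gamma> ++ dual_env \<Delta>)(z \<mapsto> trT U)"
    unfolding trT.simps
    by (rule ptyping_tr_app[where A = "trT T"])
      (use App domM_eq[OF App.hyps(1)] domM_eq[OF App.hyps(2)] in simp_all)
  then show ?case by simp
next
  case Unit
  then show ?case
    using ptyping.Bullet[OF ptyping.Zero] by simp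
next
  case (Pair D \<Gamma> M T E \<Delta> N U)
  have "tr_pair (domM D \<union> domM E) (trM D) (trM E) z \<turnstile>\<^sup>* (dual_env \<Gamma> ++ dual_env \<Delta>)(z \<mapsto> trT (Prod T U))"
    unfolding trT.simps
    by (rule ptyping_tr_pair)
      (use Pair domM_eq[OF Pair.hyps(1)] domM_eq[OF Pair.hyps(2)] in simp_all)
  then show ?case by simp
next
  case (Split D \<Gamma> M T T' E \<Delta> x y N U)
  define \<nu> where "\<nu> = fresh (domM D \<union> domM E \<union> {x, y, z})"
  have dom: "domM D = dom \<Gamma>" "domM E = insert x (insert y (dom \<Delta>))"
    and fin: "finite (dom \<Gamma>)" "finite (dom \<Delta>)"
    using domM_eq[OF Split.hyps(1)] domM_eq[OF Split.hyps(2)] by auto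
  note \<nu> = fresh[of "domM D \<union> domM E \<union> {x, y, z}", folded \<nu>_def, unfolded dom]
  have [simp]: "\<nu> i \<notin> dom \<Gamma>" "\<nu> i \<notin> dom \<Delta>" "\<nu> i \<noteq> x" "x \<noteq> \<nu> i" "\<nu> i \<noteq> y" "y \<noteq> \<nu> i"
      "\<nu> i \<noteq> z" "z \<noteq> \<nu> i" "\<nu> i = \<nu> j \<longleftrightarrow> i = j" for i j
    using \<nu>(1) \<nu>(2)[of i] fin by (auto simp: inj_eq)
  note [simp] = Split.hyps(3-5) Split.hyps(3)[symmetric]
  let ?c = "Tensor (pdual (trT T)) Bullet" and ?d = "Tensor (pdual (trT T')) Bullet"
  have outx: "Res (\<nu> 6) (\<nu> 7) (Out (\<nu> 2) (\<nu> 4) (\<nu> 6)) \<turnstile>\<^sup>* [\<nu> 2 \<mapsto> ?c, \<nu> 4 \<mapsto> trT T]"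
    using ptyping_Out_Bullet[of "\<nu> 2" "\<nu> 4" "\<nu> 6" "\<nu> 7" "pdual (trT T)"] by simp
  have outy: "Res (\<nu> 8) (\<nu> 9) (Out (\<nu> 3) (\<nu> 5) (\<nu> 8)) \<turnstile>\<^sup>* [\<nu> 3 \<mapsto> ?d, \<nu> 5 \<mapsto> trT T']"
    using ptyping_Out_Bullet[of "\<nu> 3" "\<nu> 5" "\<nu> 8" "\<nu> 9" "pdual (trT T')"] by simp
  \<comment> \<open>The hypothesis is used at \<open>\<nu> 10\<close>, since \<open>z\<close> may
    equal \<open>x\<close> or \<open>y\<close>.\<close>
  have body: "trM E (\<nu> 10) \<turnstile>\<^sup>*
      (dual_env \<Delta>)(x \<mapsto> pdual (trT T), y \<mapsto> pdual (trT T'), \<nu> 10 \<mapsto> trT U)"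
    by (rule ptyping_cong[OF Split.IH(2)[of "\<nu> 10"]]) simp_all
  let ?P = "Res (\<nu> 6) (\<nu> 7) (Out (\<nu> 2) (\<nu> 4) (\<nu> 6)) \<parallel>
      Res (\<nu> 8) (\<nu> 9) (Out (\<nu> 3) (\<nu> 5) (\<nu> 8)) \<parallel> trM E (\<nu> 10)"
  have "?P \<turnstile>\<^sup>* [\<nu> 2 \<mapsto> ?c, \<nu> 4 \<mapsto> trT T] ++ ([\<nu> 3 \<mapsto> ?d, \<nu> 5 \<mapsto> trT T'] ++
      (dual_env \<Delta>)(x \<mapsto> pdual (trT T), y \<mapsto> pdual (trT T'), \<nu> 10 \<mapsto> trT U))"
    by (intro ptyping.Par outx outy body) (auto simp: disjoint_ctx_def)
  \<comment> \<open>The order is that of the binders to come: the innermost restriction takes the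
    last two entries, the next one the two before, and the input the two before those.\<close>
  also have "\<dots> = (dual_env \<Delta>)(\<nu> 10 \<mapsto> trT U, \<nu> 2 \<mapsto> ?c, \<nu> 3 \<mapsto> ?d,
      \<nu> 4 \<mapsto> trT T, x \<mapsto> pdual (trT T), \<nu> 5 \<mapsto> trT T', y \<mapsto> pdual (trT T'))"
    by (auto simp: ctx_simps split: option.split)
  finally have "FRes (\<nu> 5) y ?P \<turnstile>\<^sup>* (dual_env \<Delta>)(\<nu> 10 \<mapsto> trT U, \<nu> 2 \<mapsto> ?c, \<nu> 3 \<mapsto> ?d,
      \<nu> 4 \<mapsto> trT T, x \<mapsto> pdual (trT T))"
    by (rule ptyping.FRes) auto
  then have "FRes (\<nu> 4) x (FRes (\<nu> 5) y ?P) \<turnstile>\<^sup>* (dual_env \<Delta>)(\<nu> 10 \<mapsto> trT U, \<nu> 2 \<mapsto> ?c, \<nu> 3 \<mapsto> ?d)"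
    by (rule ptyping.FRes) auto
  then have inp: "In (\<nu> 1) (\<nu> 2) (\<nu> 3) (FRes (\<nu> 4) x (FRes (\<nu> 5) y ?P)) \<turnstile>\<^sup>*
      (dual_env \<Delta>)(\<nu> 10 \<mapsto> trT U, \<nu> 1 \<mapsto> Parr ?c ?d)"
    by (rule ptyping.In) auto
  have "Res (\<nu> 0) (\<nu> 1) (trM D (\<nu> 0) \<parallel> In (\<nu> 1) (\<nu> 2) (\<nu> 3) (FRes (\<nu> 4) x (FRes (\<nu> 5) y ?P))) \<turnstile>\<^sup>*
      dual_env \<Gamma> ++ (dual_env \<Delta>)(\<nu> 10 \<mapsto> trT U)"
    by (rule ptyping_cut(1)[OF Split.IH(1) inp]) (use Split.hyps in \<open>auto simp: disjoint_ctx_def\<close>)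
  then have "(Res (\<nu> 0) (\<nu> 1) (trM D (\<nu> 0) \<parallel>
      In (\<nu> 1) (\<nu> 2) (\<nu> 3) (FRes (\<nu> 4) x (FRes (\<nu> 5) y ?P))))\<lbrace>z/\<nu> 10\<rbrace> \<turnstile>\<^sup>*
      (dual_env \<Gamma> ++ dual_env \<Delta>)(z \<mapsto> trT U)"
    by (intro ptyping_ren) (use Split.prems in auto)
  then show ?case
    unfolding trM.simps Let_def \<nu>_def[symmetric] by (simp del: ren.simps)
next
  case (New S)
  define \<nu> where "\<nu> = fresh {z}"
  note \<nu> = fresh[of "{z}", folded \<nu>_def]
  have [simp]: "\<nu> i \<noteq> z" "z \<noteq> \<nu> i" "\<nu> i = \<nu> j \<longleftrightarrow> i = j" for i j
    using \<nu>(1) \<nu>(2)[of i] by (auto simp: inj_eq)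
  let ?T = "Prod (Session S) (Session (sdual S))"
  let ?P = "tr_pair {\<nu> 6, \<nu> 7} (\<lambda>z. Fwd (\<nu> 6) z) (\<lambda>z. Fwd (\<nu> 7) z) z"
  \<comment> \<open>The two forwarders turn a dual pair of names into the two components of the
    pair; the double dual stays so that both entries have the form required by
    \<open>ptyping.Fwd\<close>.\<close>
  have "?P \<turnstile>\<^sup>* ([\<nu> 6 \<mapsto> pdual (trS S)] ++ [\<nu> 7 \<mapsto> pdual (pdual (trS S))])(z \<mapsto> trT ?T)"
    unfolding trT.simps trS_sdual
    by (rule ptyping_tr_pair) (auto intro: ptyping.Fwd simp: disjoint_ctx_def simp del: pdual_pdual)
  also have "\<dots> = [z \<mapsto> trT ?T, \<nu> 6 \<mapsto> pdual (trS S), \<nu> 7 \<mapsto> pdual (pdual (trS S))]"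
    by (auto simp: ctx_simps)
  finally have "Res (\<nu> 6) (\<nu> 7) ?P \<turnstile>\<^sup>* [z \<mapsto> trT ?T]"
    by (rule ptyping.Res) auto
  \<comment> \<open>The guard of \<open>New\<close> is a pure trigger: neither received name is
    used, so both get type \<open>Bullet\<close>.\<close>
  then have "Res (\<nu> 6) (\<nu> 7) ?P \<turnstile>\<^sup>* [z \<mapsto> trT ?T, \<nu> 4 \<mapsto> Bullet]"
    by (rule ptyping.Bullet) auto
  then have inp: "In (\<nu> 1) (\<nu> 4) (\<nu> 5) (Res (\<nu> 6) (\<nu> 7) ?P) \<turnstile>\<^sup>* [z \<mapsto> trT ?T, \<nu> 1 \<mapsto> Parr Bullet Bullet]"
    by (rule ptyping_In_Bullet) auto
  have "Out (\<nu> 0) (\<nu> 2) (\<nu> 3) \<turnstile>\<^sup>* [\<nu> 0 \<mapsto> Tensor Bullet Bullet, \<nu> 2 \<mapsto> Bullet, \<nu> 3 \<mapsto> pdual Bullet]"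
    using ptyping.Out[of "\<nu> 0" "\<nu> 2" "\<nu> 3" Bullet Bullet] by simp
  then have out: "Res (\<nu> 2) (\<nu> 3) (Out (\<nu> 0) (\<nu> 2) (\<nu> 3)) \<turnstile>\<^sup>* [\<nu> 0 \<mapsto> Tensor Bullet Bullet]"
    by (rule ptyping.Res) auto
  have "Res (\<nu> 0) (\<nu> 1) (Res (\<nu> 2) (\<nu> 3) (Out (\<nu> 0) (\<nu> 2) (\<nu> 3)) \<parallel>
      In (\<nu> 1) (\<nu> 4) (\<nu> 5) (Res (\<nu> 6) (\<nu> 7) ?P)) \<turnstile>\<^sup>* Map.empty ++ [z \<mapsto> trT ?T]"
    by (rule ptyping_cut(1)[OF out inp]) (auto simp: disjoint_ctx_def)
  then show ?case
    unfolding trM.simps Let_def \<nu>_def[symmetric] by simp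
next
  case (Spawn D \<Gamma> M T)
  define \<nu> where "\<nu> = fresh (domM D \<union> {z})"
  note dom = domM_eq[OF Spawn.hyps(1)]
  note \<nu> = fresh[of "domM D \<union> {z}", folded \<nu>_def, unfolded dom[THEN conjunct1]]
  have [simp]: "\<nu> i \<notin> dom \<Gamma>" "\<nu> i \<noteq> z" "z \<noteq> \<nu> i" "\<nu> i = \<nu> j \<longleftrightarrow> i = j" for i j
    using \<nu>(1) \<nu>(2)[of i] dom by (auto simp: inj_eq)
  let ?P = "Res (\<nu> 4) (\<nu> 5) (Out (\<nu> 2) (\<nu> 4) (\<nu> 5))"
  let ?Q = "Res (\<nu> 6) (\<nu> 7) (Out (\<nu> 3) z (\<nu> 6))"
  let ?c = "Tensor Bullet Bullet" and ?d = "Tensor (pdual (trT T)) Bullet"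
  have "Out (\<nu> 2) (\<nu> 4) (\<nu> 5) \<turnstile>\<^sup>* [\<nu> 2 \<mapsto> ?c, \<nu> 4 \<mapsto> Bullet, \<nu> 5 \<mapsto> pdual Bullet]"
    using ptyping.Out[of "\<nu> 2" "\<nu> 4" "\<nu> 5" Bullet Bullet] by simp
  then have P: "?P \<turnstile>\<^sup>* [\<nu> 2 \<mapsto> ?c]"
    by (rule ptyping.Res) auto
  \<comment> \<open>\<open>z\<close> itself is sent in the release signal, so the second component
    runs directly at \<open>z\<close>.\<close>
  have Q: "?Q \<turnstile>\<^sup>* [\<nu> 3 \<mapsto> ?d, z \<mapsto> trT T]"
    using ptyping_Out_Bullet[of "\<nu> 3" z "\<nu> 6" "\<nu> 7" "pdual (trT T)"] by simp
  have "?P \<parallel> ?Q \<turnstile>\<^sup>* [\<nu> 2 \<mapsto> ?c] ++ [\<nu> 3 \<mapsto> ?d, z \<mapsto> trT T]"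
    by (intro ptyping.Par P Q) (auto simp: disjoint_ctx_def)
  also have "\<dots> = [z \<mapsto> trT T, \<nu> 2 \<mapsto> ?c, \<nu> 3 \<mapsto> ?d]"
    by (auto simp: ctx_simps)
  finally have inp: "In (\<nu> 1) (\<nu> 2) (\<nu> 3) (?P \<parallel> ?Q) \<turnstile>\<^sup>* [z \<mapsto> trT T, \<nu> 1 \<mapsto> Parr ?c ?d]"
    by (rule ptyping.In) auto
  have "Res (\<nu> 0) (\<nu> 1) (trM D (\<nu> 0) \<parallel> In (\<nu> 1) (\<nu> 2) (\<nu> 3) (?P \<parallel> ?Q)) \<turnstile>\<^sup>* dual_env \<Gamma> ++ [z \<mapsto> trT T]"
    by (rule ptyping_cut(1)[OF Spawn.IH inp]) (use Spawn.prems in \<open>auto simp: disjoint_ctx_def\<close>)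
  then show ?case
    unfolding trM.simps Let_def \<nu>_def[symmetric] by simp
next
  case (EndL D \<Gamma> M T x)
  then have "trM D z \<turnstile>\<^sup>* (dual_env \<Gamma>)(z \<mapsto> trT T, x \<mapsto> Bullet)"
    by (intro ptyping.Bullet[of _ "(dual_env \<Gamma>)(z \<mapsto> trT T)"]) auto
  then show ?case
    using EndL.prems by (simp add: fun_upd_twist)
next
  case (EndR x)
  then show ?case
    using ptyping.Bullet[OF ptyping.Zero] by simp
next
  case (Send D \<Gamma> M T S)
  define \<nu> where "\<nu> = fresh (domM D \<union> {z})"
  note dom = domM_eq[OF Send.hyps(1)]
  note \<nu> = fresh[of "domM D \<union> {z}", folded \<nu>_def, unfolded dom[THEN conjunct1]]
  have [simp]: "\<nu> i \<notin> dom \<Gamma>" "\<nu> i \<noteq> z" "z \<noteq> \<nu> i" "\<nu> i = \<nu> j \<longleftrightarrow> i = j" for i j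
    using \<nu>(1) \<nu>(2)[of i] dom by (auto simp: inj_eq)
  let ?P = "Res (\<nu> 6) (\<nu> 7) (Out (\<nu> 3) (\<nu> 4) (\<nu> 6))"
  let ?Q = "Res (\<nu> 8) (\<nu> 9) (Out (\<nu> 5) (\<nu> 2) (\<nu> 8) \<parallel> Fwd (\<nu> 9) z)"
  let ?S = "trS (SSend T S)"
  let ?c = "Tensor (pdual (trT T)) Bullet" and ?d = "Tensor (pdual ?S) Bullet"
  have P: "?P \<turnstile>\<^sup>* [\<nu> 3 \<mapsto> ?d, \<nu> 4 \<mapsto> ?S]"
    using ptyping_Out_Bullet[of "\<nu> 3" "\<nu> 4" "\<nu> 6" "\<nu> 7" "pdual ?S"] by simp
  \<comment> \<open>The payload \<open>\<nu> 2\<close> is passed on still suspended: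
    \<open>?c\<close> is the dual of \<open>Parr (trT T) Bullet\<close>.\<close>
  have Q: "?Q \<turnstile>\<^sup>* [\<nu> 2 \<mapsto> ?c, z \<mapsto> trS S, \<nu> 5 \<mapsto> pdual ?S]"
    using ptyping_Out_Fwd[of "\<nu> 5" "\<nu> 2" z "\<nu> 8" "\<nu> 9" "Parr (trT T) Bullet" "trS S"] by simp
  have "Res (\<nu> 4) (\<nu> 5) (?P \<parallel> ?Q) \<turnstile>\<^sup>* [z \<mapsto> trS S, \<nu> 2 \<mapsto> ?c, \<nu> 3 \<mapsto> ?d]"
    by (rule ptyping_cong[OF ptyping_cut(1)[OF P Q]]) (auto simp: ctx_simps)
  then have inp: "In (\<nu> 1) (\<nu> 2) (\<nu> 3) (Res (\<nu> 4) (\<nu> 5) (?P \<parallel> ?Q)) \<turnstile>\<^sup>* [z \<mapsto> trS S, \<nu> 1 \<mapsto> Parr ?c ?d]"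
    by (rule ptyping.In) auto
  have "Res (\<nu> 0) (\<nu> 1) (trM D (\<nu> 0) \<parallel> In (\<nu> 1) (\<nu> 2) (\<nu> 3) (Res (\<nu> 4) (\<nu> 5) (?P \<parallel> ?Q))) \<turnstile>\<^sup>*
      dual_env \<Gamma> ++ [z \<mapsto> trS S]"
    by (rule ptyping_cut(1)[OF Send.IH inp]) (use Send.prems in \<open>auto simp: disjoint_ctx_def\<close>)
  then show ?case
    unfolding trM.simps Let_def \<nu>_def[symmetric] by simp
next
  case (Recv D \<Gamma> M T S)
  define \<nu> where "\<nu> = fresh (domM D \<union> {z})"
  note dom = domM_eq[OF Recv.hyps(1)]
  note \<nu> = fresh[of "domM D \<union> {z}", folded \<nu>_def, unfolded dom[THEN conjunct1]]
  have [simp]: "\<nu> i \<notin> dom \<Gamma>" "\<nu> i \<noteq> z" "z \<noteq> \<nu> i" "\<nu> i = \<nu> j \<longleftrightarrow> i = j" for i j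
    using \<nu>(1) \<nu>(2)[of i] dom by (auto simp: inj_eq)
  let ?P = "Out z (\<nu> 2) (\<nu> 4)" and ?Q = "In (\<nu> 5) (\<nu> 6) (\<nu> 7) (Fwd (\<nu> 3) (\<nu> 6))"
  let ?T = "trT (Prod T (Session S))"
  let ?c = "Tensor (pdual (trT T)) Bullet" and ?d = "pdual (trS S)"
  have P: "?P \<turnstile>\<^sup>* [z \<mapsto> ?T, \<nu> 2 \<mapsto> ?c](\<nu> 4 \<mapsto> pdual (Parr (trS S) Bullet))"
    using ptyping.Out[of z "\<nu> 2" "\<nu> 4" "Parr (trT T) Bullet" "Parr (trS S) Bullet"] by simp
  \<comment> \<open>A received session continuation is not suspended, but the second component of a
    translated pair is; this input adds the missing guard.\<close>
  have Q: "?Q \<turnstile>\<^sup>* [\<nu> 3 \<mapsto> ?d, \<nu> 5 \<mapsto> Parr (trS S) Bullet]"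
    by (intro ptyping_In_Bullet ptyping.Fwd) auto
  have "Res (\<nu> 4) (\<nu> 5) (?P \<parallel> ?Q) \<turnstile>\<^sup>* [z \<mapsto> ?T, \<nu> 2 \<mapsto> ?c, \<nu> 3 \<mapsto> ?d]"
    by (rule ptyping_cong[OF ptyping_cut(1)[OF P Q]]) (auto simp: ctx_simps)
  then have inp: "In (\<nu> 1) (\<nu> 2) (\<nu> 3) (Res (\<nu> 4) (\<nu> 5) (?P \<parallel> ?Q)) \<turnstile>\<^sup>* [z \<mapsto> ?T, \<nu> 1 \<mapsto> Parr ?c ?d]"
    by (rule ptyping.In) auto
  have "Res (\<nu> 0) (\<nu> 1) (trM D (\<nu> 0) \<parallel> In (\<nu> 1) (\<nu> 2) (\<nu> 3) (Res (\<nu> 4) (\<nu> 5) (?P \<parallel> ?Q))) \<turnstile>\<^sup>*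
      dual_env \<Gamma> ++ [z \<mapsto> ?T]"
    by (rule ptyping_cut(1)[OF Recv.IH inp]) (use Recv.prems in \<open>auto simp: disjoint_ctx_def\<close>)
  then show ?case
    unfolding trM.simps Let_def \<nu>_def[symmetric] by simp
next
  case (Select D \<Gamma> M Ss j S)
  define \<nu> where "\<nu> = fresh (domM D \<union> {z})"
  note dom = domM_eq[OF Select.hyps(1)]
  note \<nu> = fresh[of "domM D \<union> {z}", folded \<nu>_def, unfolded dom[THEN conjunct1]]
  have [simp]: "\<nu> i \<notin> dom \<Gamma>" "\<nu> i \<noteq> z" "z \<noteq> \<nu> i" "\<nu> i = \<nu> j \<longleftrightarrow> i = j" for i j
    using \<nu>(1) \<nu>(2)[of i] dom by (auto simp: inj_eq)
  let ?B = "pdual (trS (SSelect Ss))"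
  have sel: "Sel (\<nu> 1) (\<nu> 2) j \<turnstile>\<^sup>* [\<nu> 1 \<mapsto> ?B, \<nu> 2 \<mapsto> trS S]"
    using ptyping.Sel[of "map_option pdual \<circ> (map_option trS \<circ> Ss)" j "pdual (trS S)" "\<nu> 1" "\<nu> 2"]
      Select.hyps(2) by simp
  have fwd: "Fwd (\<nu> 3) z \<turnstile>\<^sup>* [z \<mapsto> trS S, \<nu> 3 \<mapsto> pdual (trS S)]"
    by (rule ptyping_cong[OF ptyping.Fwd[of _ _ "trS S"]]) (auto simp: ctx_simps)
  have arg: "Res (\<nu> 2) (\<nu> 3) (Sel (\<nu> 1) (\<nu> 2) j \<parallel> Fwd (\<nu> 3) z) \<turnstile>\<^sup>* [z \<mapsto> trS S, \<nu> 1 \<mapsto> ?B]"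
    by (rule ptyping_cong[OF ptyping_cut(1)[OF sel fwd]]) (auto simp: ctx_simps)
  have "Res (\<nu> 0) (\<nu> 1) (trM D (\<nu> 0) \<parallel> Res (\<nu> 2) (\<nu> 3) (Sel (\<nu> 1) (\<nu> 2) j \<parallel> Fwd (\<nu> 3) z)) \<turnstile>\<^sup>*
      dual_env \<Gamma> ++ [z \<mapsto> trS S]"
    by (rule ptyping_cut(1)[OF Select.IH arg]) (use Select.prems in \<open>auto simp: disjoint_ctx_def\<close>)
  then show ?case
    unfolding trM.simps Let_def \<nu>_def[symmetric] by simp
next
  case (Case D \<Gamma> M Ss Ns Es \<Delta> U)
  define \<nu> where "\<nu> = fresh (domM D \<union> dom \<Delta> \<union> {z})"
  note dom = domM_eq[OF Case.hyps(1)]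
  note \<nu> = fresh[of "domM D \<union> dom \<Delta> \<union> {z}", folded \<nu>_def, unfolded dom[THEN conjunct1]]
  have [simp]: "\<nu> i \<notin> dom \<Gamma>" "\<nu> i \<notin> dom \<Delta>" "\<nu> i \<noteq> z" "z \<noteq> \<nu> i" "\<nu> i = \<nu> j \<longleftrightarrow> i = j" for i j
    using \<nu>(1) \<nu>(2)[of i] dom Case.hyps by (auto simp: inj_eq)
  define Ps where "Ps = map_option (\<lambda>E. tr_app (dom \<Delta> \<union> {\<nu> 2}) (trM E) (\<lambda>z. Fwd (\<nu> 2) z) z) \<circ> Es"
  have bra: "Bra (\<nu> 1) (\<nu> 2) Ps \<turnstile>\<^sup>* (dual_env \<Delta>)(z \<mapsto> trT U, \<nu> 1 \<mapsto> pdual (trS (SBranch Ss)))"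
    unfolding trS.simps pdual.simps
  proof (rule ptyping.Bra)
    show "dom Ps = dom (map_option pdual \<circ> (map_option trS \<circ> Ss))"
      using Case.hyps(3) by (auto simp: Ps_def dom_def)
    fix i P A
    assume P: "Ps i = Some P" and "(map_option pdual \<circ> (map_option trS \<circ> Ss)) i = Some A"
    then obtain S where S: "Ss i = Some S" "A = pdual (trS S)"
      by auto
    obtain E where E: "Es i = Some E" "P = tr_app (dom \<Delta> \<union> {\<nu> 2}) (trM E) (\<lambda>z. Fwd (\<nu> 2) z) z"
      using P by (auto simp: Ps_def)
    obtain N where N: "Ns i = Some N"
      using S Case.hyps(2) by blast
    \<comment> \<open>Each branch applies the translated function to the name \<open>\<nu> 2\<close>
      received with the label, so the argument context is the singleton of that name.\<close>
    have "P \<turnstile>\<^sup>* (dual_env \<Delta> ++ [\<nu> 2 \<mapsto> A])(z \<mapsto> trT U)"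
      unfolding E(2)
    proof (rule ptyping_tr_app)
      show "trM E a \<turnstile>\<^sup>* (dual_env \<Delta>)(a \<mapsto> Parr (Tensor (pdual (trS S)) Bullet) (trT U))"
        if "a \<notin> dom (dual_env \<Delta>)" for a
        using Case.IH(2)[OF S(1) N E(1), of a] that by simp
      show "Fwd (\<nu> 2) e \<turnstile>\<^sup>* [\<nu> 2 \<mapsto> A, e \<mapsto> trS S]" if "e \<notin> dom [\<nu> 2 \<mapsto> A]" for e
        unfolding S(2) using that by (intro ptyping.Fwd) auto
    qed (use Case.prems Case.hyps in \<open>auto simp: disjoint_ctx_def\<close>)
    then show "P \<turnstile>\<^sup>* (dual_env \<Delta>)(z \<mapsto> trT U, \<nu> 2 \<mapsto> A)"
      by (simp add: fun_upd_twist)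
  qed (use Case.hyps in auto)
  have "Res (\<nu> 0) (\<nu> 1) (trM D (\<nu> 0) \<parallel> Bra (\<nu> 1) (\<nu> 2) Ps) \<turnstile>\<^sup>* dual_env \<Gamma> ++ (dual_env \<Delta>)(z \<mapsto> trT U)"
    by (rule ptyping_cut(1)[OF Case.IH(1) bra])
      (use Case.prems Case.hyps in \<open>auto simp: disjoint_ctx_def\<close>)
  then show ?case
    unfolding trM.simps Let_def \<nu>_def[symmetric] by (simp add: Ps_def)
next
  case (Sub D \<Gamma> x T M U E \<Delta> N)
  define \<nu> where "\<nu> = fresh (domM D \<union> domM E \<union> {x, z})"
  have dom: "domM D = insert x (dom \<Gamma>)" "domM E = dom \<Delta>"
    and fin: "finite (dom \<Gamma>)" "finite (dom \<Delta>)"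
    using domM_eq[OF Sub.hyps(1)] domM_eq[OF Sub.hyps(2)] by auto
  note \<nu> = fresh[of "domM D \<union> domM E \<union> {x, z}", folded \<nu>_def, unfolded dom]
  have [simp]: "\<nu> i \<notin> dom \<Gamma>" "\<nu> i \<notin> dom \<Delta>" "\<nu> i \<noteq> x" "x \<noteq> \<nu> i" "\<nu> i \<noteq> z" "z \<noteq> \<nu> i"
      "\<nu> i = \<nu> j \<longleftrightarrow> i = j" for i j
    using \<nu>(1) \<nu>(2)[of i] fin by (auto simp: inj_eq)
  note [simp] = Sub.hyps(3,4)
  have body: "trM D (\<nu> 1) \<turnstile>\<^sup>* (dual_env \<Gamma>)(\<nu> 1 \<mapsto> trT U, x \<mapsto> pdual (trT T))"
    by (rule ptyping_cong[OF Sub.IH(1)[of "\<nu> 1"]]) (simp_all add: fun_upd_twist)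
  have "FRes x (\<nu> 0) (trM D (\<nu> 1) \<parallel> trM E (\<nu> 0)) \<turnstile>\<^sup>* (dual_env \<Gamma> ++ dual_env \<Delta>)(\<nu> 1 \<mapsto> trT U)"
    by (rule ptyping_cong[OF ptyping_cut(2)[OF body Sub.IH(2)]])
      (use Sub.hyps in \<open>auto simp: disjoint_ctx_def map_add_upd_left\<close>)
  then have "(FRes x (\<nu> 0) (trM D (\<nu> 1) \<parallel> trM E (\<nu> 0)))\<lbrace>z/\<nu> 1\<rbrace> \<turnstile>\<^sup>*
      (dual_env \<Gamma> ++ dual_env \<Delta>)(z \<mapsto> trT U)"
    by (intro ptyping_ren) (use Sub.prems in auto)
  then show ?case
    unfolding trM.simps Let_def \<nu>_def[symmetric] by (simp del: ren.simps)
next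
  case (Send' D \<Gamma> M T E \<Delta> N S)
  define \<nu> where "\<nu> = fresh (domM D \<union> domM E \<union> {z})"
  have dom: "domM D = dom \<Gamma>" "domM E = dom \<Delta>" and fin: "finite (dom \<Gamma>)" "finite (dom \<Delta>)"
    using domM_eq[OF Send'.hyps(1)] domM_eq[OF Send'.hyps(2)] by auto
  note \<nu> = fresh[of "domM D \<union> domM E \<union> {z}", folded \<nu>_def, unfolded dom]
  have [simp]: "\<nu> i \<notin> dom \<Gamma>" "\<nu> i \<notin> dom \<Delta>" "\<nu> i \<noteq> z" "z \<noteq> \<nu> i" "\<nu> i = \<nu> j \<longleftrightarrow> i = j" for i j
    using \<nu>(1) \<nu>(2)[of i] fin by (auto simp: inj_eq)
  note [simp] = Send'.prems[simplified]
  have inp: "In (\<nu> 0) (\<nu> 2) (\<nu> 3) (trM D (\<nu> 2)) \<turnstile>\<^sup>* (dual_env \<Gamma>)(\<nu> 0 \<mapsto> Parr (trT T) Bullet)"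
    by (rule ptyping_In_Bullet[OF Send'.IH(1)]) auto
  let ?P = "Res (\<nu> 6) (\<nu> 7) (Out (\<nu> 5) (\<nu> 1) (\<nu> 6) \<parallel> Fwd (\<nu> 7) z)"
  have P: "?P \<turnstile>\<^sup>* [\<nu> 1 \<mapsto> pdual (Parr (trT T) Bullet), z \<mapsto> trS S,
      \<nu> 5 \<mapsto> Tensor (Parr (trT T) Bullet) (pdual (trS S))]"
    by (rule ptyping_Out_Fwd) simp
  have arg: "Res (\<nu> 4) (\<nu> 5) (trM E (\<nu> 4) \<parallel> ?P) \<turnstile>\<^sup>*
      (dual_env \<Delta>)(z \<mapsto> trS S, \<nu> 1 \<mapsto> pdual (Parr (trT T) Bullet))"
    by (rule ptyping_cong[OF ptyping_cut(1)[OF Send'.IH(2) P]])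
      (auto simp: ctx_simps)
  have "Res (\<nu> 0) (\<nu> 1) (In (\<nu> 0) (\<nu> 2) (\<nu> 3) (trM D (\<nu> 2)) \<parallel> Res (\<nu> 4) (\<nu> 5) (trM E (\<nu> 4) \<parallel> ?P)) \<turnstile>\<^sup>*
      dual_env \<Gamma> ++ (dual_env \<Delta>)(z \<mapsto> trS S)"
    by (rule ptyping_cut(1)[OF inp arg]) (use Send'.hyps in \<open>auto simp: disjoint_ctx_def\<close>)
  then show ?case
    unfolding trM.simps Let_def \<nu>_def[symmetric] by simp
qed

section \<open>Typing of translated buffers\<close>

text \<open>The last message forms the outermost layer, and the rest of the buffer is built around
  \<open>P\<close> at a new name. Hence \<open>x\<close> and \<open>P\<close> vary in the induction,
  while \<open>\<Lambda>\<close> and the type \<open>pdual (trS S')\<close> at which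
  \<open>P\<close> is plugged in stay the same.\<close>

lemma ptyping_trB:
  "\<lbrakk>B \<^bold>: \<Gamma> \<turnstile>\<^sub>B [ms\<rangle> : S' > S; x \<notin> dom \<Lambda>; x \<notin> dom \<Gamma>; dual_env \<Gamma> \<bottom> \<Lambda>;
    P \<turnstile>\<^sup>* \<Lambda>(x \<mapsto> pdual (trS S'))\<rbrakk>
    \<Longrightarrow> trB B (dom \<Lambda>) x P \<turnstile>\<^sup>* (dual_env \<Gamma> ++ \<Lambda>)(x \<mapsto> pdual (trS S))"
proof (induction arbitrary: x P rule: derivB.induct)
  case (Buf S')
  then show ?case by simp
next
  case (BufSend D \<Gamma> M T B \<Delta> ms S' S)
  define \<nu> where "\<nu> = fresh (domM D \<union> domB B \<union> dom \<Lambda> \<union> {x})"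
  have dom: "domM D = dom \<Gamma>" "domB B = dom \<Delta>" and fin: "finite (dom \<Gamma>)" "finite (dom \<Delta>)"
    using domM_eq[OF BufSend.hyps(1)] domB_eq[OF BufSend.hyps(2)] by auto
  have fin\<Lambda>: "finite (dom \<Lambda>)"
    using ptyping_finite[OF BufSend.prems(4)] by simp
  note \<nu> = fresh[of "domM D \<union> domB B \<union> dom \<Lambda> \<union> {x}", folded \<nu>_def, unfolded dom]
  have [simp]: "\<nu> i \<notin> dom \<Gamma>" "\<nu> i \<notin> dom \<Delta>" "\<nu> i \<notin> dom \<Lambda>" "\<nu> i \<noteq> x" "x \<noteq> \<nu> i"
      "\<nu> i = \<nu> j \<longleftrightarrow> i = j" for i j
    using \<nu>(1) \<nu>(2)[of i] fin fin\<Lambda> by (auto simp: inj_eq)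
  have disj: "dual_env \<Gamma> \<bottom> \<Lambda>" "dual_env \<Delta> \<bottom> \<Lambda>" "\<Gamma> \<bottom> \<Delta>" and [simp]: "x \<notin> dom \<Gamma>" "x \<notin> dom \<Delta>" "x \<notin> dom \<Lambda>"
    using BufSend.prems BufSend.hyps by (auto simp: disjoint_ctx_def)
  have [simp]: "\<Lambda> x = None" "\<Lambda> (\<nu> i) = None" for i
    using notin_dom_None[of _ \<Lambda>] by simp_all
  let ?X = "pdual (trS (SSend T S))"
  let ?P = "Res (\<nu> 6) (\<nu> 7) (Fwd x (\<nu> 6) \<parallel> Out (\<nu> 7) (\<nu> 0) (\<nu> 2))"
  let ?Q = "In (\<nu> 1) (\<nu> 4) (\<nu> 5) (trM D (\<nu> 4))"
  let ?R = "trB B (dom \<Lambda>) (\<nu> 3) (P\<lbrace>\<nu> 3/x\<rbrace>)"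
  have fwd: "Fwd x (\<nu> 6) \<turnstile>\<^sup>* [x \<mapsto> ?X, \<nu> 6 \<mapsto> trS (SSend T S)]"
    by (rule ptyping.Fwd) simp
  have out: "Out (\<nu> 7) (\<nu> 0) (\<nu> 2) \<turnstile>\<^sup>* [\<nu> 0 \<mapsto> pdual (Parr (trT T) Bullet), \<nu> 2 \<mapsto> trS S, \<nu> 7 \<mapsto> ?X]"
    by (rule ptyping_cong[OF ptyping.Out[of _ _ _ "Parr (trT T) Bullet" "pdual (trS S)"]]) (auto simp: ctx_simps)
  have P: "?P \<turnstile>\<^sup>* [x \<mapsto> ?X, \<nu> 0 \<mapsto> pdual (Parr (trT T) Bullet)](\<nu> 2 \<mapsto> trS S)"
    by (rule ptyping_cong[OF ptyping_cut(1)[OF fwd out]]) (auto simp: ctx_simps)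
  have Q: "?Q \<turnstile>\<^sup>* (dual_env \<Gamma>)(\<nu> 1 \<mapsto> Parr (trT T) Bullet)"
    by (rule ptyping_In_Bullet[OF ptyping_trM[OF BufSend.hyps(1)]]) auto
  \<comment> \<open>\<open>\<nu> 3\<close> avoids all of \<open>dom \<Lambda>\<close>, including
    names that \<open>P\<close> does not mention, so \<open>ptyping_ren\<close> supplies the premise
    on the renamed process.\<close>
  have R: "?R \<turnstile>\<^sup>* (dual_env \<Delta> ++ \<Lambda>)(\<nu> 3 \<mapsto> pdual (trS S))"
    by (intro BufSend.IH ptyping_ren) (use BufSend.prems disj in auto)
  have QR: "?Q \<parallel> ?R \<turnstile>\<^sup>*
      ((dual_env \<Gamma> ++ dual_env \<Delta> ++ \<Lambda>)(\<nu> 1 \<mapsto> Parr (trT T) Bullet))(\<nu> 3 \<mapsto> pdual (trS S))"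
    by (rule ptyping_cong[OF ptyping.Par[OF Q R]])
      (use disj in \<open>auto simp: disjoint_ctx_def map_add_upd_left\<close>)
  have "Res (\<nu> 2) (\<nu> 3) (?P \<parallel> ?Q \<parallel> ?R) \<turnstile>\<^sup>* (dual_env \<Gamma> ++ dual_env \<Delta> ++ \<Lambda>)
      (x \<mapsto> ?X, \<nu> 0 \<mapsto> pdual (Parr (trT T) Bullet), \<nu> 1 \<mapsto> pdual (pdual (Parr (trT T) Bullet)))"
    by (rule ptyping_cong[OF ptyping_cut(1)[OF P QR]])
      (auto simp: ctx_simps split: option.split)
  then have "Res (\<nu> 0) (\<nu> 1) (Res (\<nu> 2) (\<nu> 3) (?P \<parallel> ?Q \<parallel> ?R)) \<turnstile>\<^sup>*
      (dual_env \<Gamma> ++ dual_env \<Delta> ++ \<Lambda>)(x \<mapsto> ?X)"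
    by (rule ptyping.Res) auto
  then show ?case
    unfolding trB.simps Let_def \<nu>_def[symmetric] by simp
next
  case (BufSelect B \<Gamma> ms S' S Ss j)
  define \<nu> where "\<nu> = fresh (domB B \<union> dom \<Lambda> \<union> {x})"
  note dom = domB_eq[OF BufSelect.hyps(1)]
  have fin: "finite (dom \<Lambda>)"
    using ptyping_finite[OF BufSelect.prems(4)] by simp
  note \<nu> = fresh[of "domB B \<union> dom \<Lambda> \<union> {x}", folded \<nu>_def, unfolded dom[THEN conjunct1]]
  have [simp]: "\<nu> i \<notin> dom \<Gamma>" "\<nu> i \<notin> dom \<Lambda>" "\<nu> i \<noteq> x" "x \<noteq> \<nu> i" "\<nu> i = \<nu> j \<longleftrightarrow> i = j" for i j
    using \<nu>(1) \<nu>(2)[of i] dom fin by (auto simp: inj_eq)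
  note [simp] = BufSelect.prems(1,2)
  have [simp]: "\<Lambda> x = None" "\<Lambda> (\<nu> i) = None" for i
    using notin_dom_None[of _ \<Lambda>] by simp_all
  let ?X = "pdual (trS (SSelect Ss))"
  let ?R = "trB B (dom \<Lambda>) (\<nu> 1) (P\<lbrace>\<nu> 1/x\<rbrace>)"
  have fwd: "Fwd x (\<nu> 2) \<turnstile>\<^sup>* [x \<mapsto> ?X, \<nu> 2 \<mapsto> trS (SSelect Ss)]"
    by (rule ptyping.Fwd) simp
  have "Sel (\<nu> 3) (\<nu> 0) j \<turnstile>\<^sup>* [\<nu> 3 \<mapsto> ?X, \<nu> 0 \<mapsto> pdual (pdual (trS S))]"
    unfolding trS.simps pdual.simps by (rule ptyping.Sel) (use BufSelect.hyps in auto)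
  then have sel: "Sel (\<nu> 3) (\<nu> 0) j \<turnstile>\<^sup>* [\<nu> 0 \<mapsto> trS S, \<nu> 3 \<mapsto> ?X]"
    by (rule ptyping_cong) (auto simp: ctx_simps)
  have P: "Res (\<nu> 2) (\<nu> 3) (Fwd x (\<nu> 2) \<parallel> Sel (\<nu> 3) (\<nu> 0) j) \<turnstile>\<^sup>* [x \<mapsto> ?X](\<nu> 0 \<mapsto> trS S)"
    by (rule ptyping_cong[OF ptyping_cut(1)[OF fwd sel]]) (auto simp: ctx_simps)
  have R: "?R \<turnstile>\<^sup>* (dual_env \<Gamma> ++ \<Lambda>)(\<nu> 1 \<mapsto> pdual (trS S))"
    by (intro BufSelect.IH ptyping_ren) (use BufSelect.prems in auto)
  have "Res (\<nu> 0) (\<nu> 1) (Res (\<nu> 2) (\<nu> 3) (Fwd x (\<nu> 2) \<parallel> Sel (\<nu> 3) (\<nu> 0) j) \<parallel> ?R) \<turnstile>\<^sup>*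
      (dual_env \<Gamma> ++ \<Lambda>)(x \<mapsto> ?X)"
    by (rule ptyping_cong[OF ptyping_cut(1)[OF P R]])
      (auto simp: ctx_simps split: option.split)
  then show ?case
    unfolding trB.simps Let_def \<nu>_def[symmetric] by simp
qed

section \<open>Typing of translated configurations\<close>

lemma ptyping_trC:
  "\<lbrakk>D \<^bold>: \<Gamma> \<turnstile>\<^sub>C[\<phi>] C : T; z \<notin> dom \<Gamma>\<rbrakk> \<Longrightarrow> trC D z \<turnstile>\<^sup>* (dual_env \<Gamma>)(z \<mapsto> trT T)"
proof (induction arbitrary: z rule: derivC.induct)
  case (Main D \<Gamma> M T)
  then show ?case by (simp add: ptyping_trM)
next
  case (Child D \<Gamma> M)
  then show ?case
    unfolding trC.simps by (intro ptyping_trM)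
next
  case (ParL D \<Gamma> C\<^sub>1 E \<Delta> \<phi> C\<^sub>2 T \<psi>)
  define \<nu> where "\<nu> = fresh (domC D \<union> domC E \<union> {z})"
  have dom: "domC D = dom \<Gamma>" "domC E = dom \<Delta>" and fin: "finite (dom \<Gamma>)" "finite (dom \<Delta>)"
    using domC_eq[OF ParL.hyps(1)] domC_eq[OF ParL.hyps(2)] by auto
  note \<nu> = fresh[of "domC D \<union> domC E \<union> {z}", folded \<nu>_def, unfolded dom]
  have [simp]: "\<nu> i \<notin> dom \<Gamma>" "\<nu> i = \<nu> j \<longleftrightarrow> i = j" for i j
    using \<nu>(1) \<nu>(2)[of i] fin by (auto simp: inj_eq)
  have "Res (\<nu> 0) (\<nu> 1) (trC D (\<nu> 0)) \<turnstile>\<^sup>* dual_env \<Gamma>"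
    by (rule ptyping_Res_Bullet) (use ParL.IH(1)[of "\<nu> 0"] in auto)
  moreover have "trC E z \<turnstile>\<^sup>* (dual_env \<Delta>)(z \<mapsto> trT T)"
    using ParL.IH(2) ParL.prems by simp
  ultimately have "Res (\<nu> 0) (\<nu> 1) (trC D (\<nu> 0)) \<parallel> trC E z \<turnstile>\<^sup>* dual_env \<Gamma> ++ (dual_env \<Delta>)(z \<mapsto> trT T)"
    by (rule ptyping.Par) (use ParL.hyps ParL.prems in \<open>auto simp: disjoint_ctx_def\<close>)
  then show ?case
    unfolding trC.simps Let_def \<nu>_def[symmetric] by simp
next
  case (ParR D \<Gamma> \<phi> C\<^sub>1 T E \<Delta> C\<^sub>2 \<psi>)
  define \<nu> where "\<nu> = fresh (domC D \<union> domC E \<union> {z})"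
  have dom: "domC D = dom \<Gamma>" "domC E = dom \<Delta>" and fin: "finite (dom \<Gamma>)" "finite (dom \<Delta>)"
    using domC_eq[OF ParR.hyps(1)] domC_eq[OF ParR.hyps(2)] by auto
  note \<nu> = fresh[of "domC D \<union> domC E \<union> {z}", folded \<nu>_def, unfolded dom]
  have [simp]: "\<nu> i \<notin> dom \<Delta>" "\<nu> i = \<nu> j \<longleftrightarrow> i = j" for i j
    using \<nu>(1) \<nu>(2)[of i] fin by (auto simp: inj_eq)
  have "trC D z \<turnstile>\<^sup>* (dual_env \<Gamma>)(z \<mapsto> trT T)"
    using ParR.IH(1) ParR.prems by simp
  moreover have "Res (\<nu> 0) (\<nu> 1) (trC E (\<nu> 0)) \<turnstile>\<^sup>* dual_env \<Delta>"
    by (rule ptyping_Res_Bullet) (use ParR.IH(2)[of "\<nu> 0"] in auto)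
  ultimately have "trC D z \<parallel> Res (\<nu> 0) (\<nu> 1) (trC E (\<nu> 0)) \<turnstile>\<^sup>* (dual_env \<Gamma>)(z \<mapsto> trT T) ++ dual_env \<Delta>"
    by (rule ptyping.Par) (use ParR.hyps ParR.prems in \<open>auto simp: disjoint_ctx_def\<close>)
  then show ?case
    unfolding trC.simps Let_def \<nu>_def[symmetric] using ParR.prems by (simp add: map_add_upd_left)
next
  case (Res B \<Gamma> ms S' S D \<Delta> x y \<phi> C T)
  define w where "w = fresh (domB B \<union> domC D \<union> {x, y, z}) 0"
  have dom: "domB B = dom \<Gamma>" "domC D = insert x (insert y (dom \<Delta>))"
    and fin: "finite (dom \<Gamma>)" "finite (dom \<Delta>)"
    using domB_eq[OF Res.hyps(1)] domC_eq[OF Res.hyps(2)] by auto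
  have w [simp]: "w \<notin> dom \<Gamma>" "w \<notin> dom \<Delta>" "w \<noteq> x" "w \<noteq> y" "w \<noteq> z" "x \<noteq> w" "y \<noteq> w"
    using fresh(2)[of "domB B \<union> domC D \<union> {x, y, z}" 0, folded w_def] dom fin by auto
  note [simp] = Res.hyps(3-7)
  \<comment> \<open>Everything in the context of the translated configuration except
    \<open>x\<close>, the end at which the buffer is inserted; thus both \<open>y\<close> and the
    provided name \<open>w\<close> belong to it.\<close>
  define \<Lambda> where "\<Lambda> = (dual_env \<Delta>)(y \<mapsto> trS S, w \<mapsto> trT T)"
  have L: "domC D - {x} \<union> {w} = dom \<Lambda>"
    by (auto simp: \<Lambda>_def dom)
  have "trC D w \<turnstile>\<^sup>* (dual_env \<Delta>)(x \<mapsto> pdual (trS S'), y \<mapsto> trS S, w \<mapsto> trT T)"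
    using Res.IH[of w] by simp
  also have "\<dots> = \<Lambda>(x \<mapsto> pdual (trS S'))"
    by (auto simp: \<Lambda>_def ctx_simps split: option.split)
  finally have "trB B (dom \<Lambda>) x (trC D w) \<turnstile>\<^sup>* (dual_env \<Gamma> ++ \<Lambda>)(x \<mapsto> pdual (trS S))"
    by (intro ptyping_trB[OF Res.hyps(1)]) (use Res.hyps in \<open>auto simp: \<Lambda>_def disjoint_ctx_def\<close>)
  \<comment> \<open>The buffer has changed the type at \<open>x\<close> from \<open>S'\<close> to
    \<open>S\<close>. This makes \<open>x\<close> dual to \<open>y\<close>, which was left untouched
    in \<Lambda>.\<close>
  also have "(dual_env \<Gamma> ++ \<Lambda>)(x \<mapsto> pdual (trS S)) =
      (dual_env \<Gamma> ++ dual_env \<Delta>)(w \<mapsto> trT T, x \<mapsto> pdual (trS S), y \<mapsto> pdual (pdual (trS S)))"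
    by (auto simp: \<Lambda>_def ctx_simps split: option.split)
  finally have "Res x y (trB B (dom \<Lambda>) x (trC D w)) \<turnstile>\<^sup>* (dual_env \<Gamma> ++ dual_env \<Delta>)(w \<mapsto> trT T)"
    by (rule ptyping.Res) auto
  then have "(Res x y (trB B (dom \<Lambda>) x (trC D w)))\<lbrace>z/w\<rbrace> \<turnstile>\<^sup>* (dual_env \<Gamma> ++ dual_env \<Delta>)(z \<mapsto> trT T)"
    by (intro ptyping_ren) (use Res.prems in auto)
  then show ?case
    unfolding trC.simps Let_def w_def[symmetric] L by simp
next
  case (ResBuf B \<Gamma> y S ms S' D \<Delta> x \<phi> C T)
  define w where "w = fresh (domB B \<union> domC D \<union> {x, y, z}) 0"
  have dom: "domB B = insert y (dom \<Gamma>)" "domC D = insert x (dom \<Delta>)"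
    and fin: "finite (dom \<Gamma>)" "finite (dom \<Delta>)"
    using domB_eq[OF ResBuf.hyps(1)] domC_eq[OF ResBuf.hyps(2)] by auto
  have w [simp]: "w \<notin> dom \<Gamma>" "w \<notin> dom \<Delta>" "w \<noteq> x" "w \<noteq> y" "w \<noteq> z" "x \<noteq> w" "y \<noteq> w"
    using fresh(2)[of "domB B \<union> domC D \<union> {x, y, z}" 0, folded w_def] dom fin by auto
  note [simp] = ResBuf.hyps(3-7)
  define \<Lambda> where "\<Lambda> = (dual_env \<Delta>)(w \<mapsto> trT T)"
  have L: "domC D - {x} \<union> {w} = dom \<Lambda>"
    by (auto simp: \<Lambda>_def dom)
  have "trC D w \<turnstile>\<^sup>* \<Lambda>(x \<mapsto> pdual (trS S'))"
    using ResBuf.IH[of w] by (simp add: \<Lambda>_def fun_upd_twist)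
  then have "trB B (dom \<Lambda>) x (trC D w) \<turnstile>\<^sup>*
      (dual_env (\<Gamma>(y \<mapsto> Session (sdual S))) ++ \<Lambda>)(x \<mapsto> pdual (trS S))"
    by (intro ptyping_trB[OF ResBuf.hyps(1)]) (use ResBuf.hyps in \<open>auto simp: \<Lambda>_def disjoint_ctx_def\<close>)
  \<comment> \<open>Here \<open>y\<close> is used by a message, so its entry comes from the context
    of the buffer and not from \<Lambda>; the resulting pair is the same.\<close>
  also have "(dual_env (\<Gamma>(y \<mapsto> Session (sdual S))) ++ \<Lambda>)(x \<mapsto> pdual (trS S)) =
      (dual_env \<Gamma> ++ dual_env \<Delta>)(w \<mapsto> trT T, x \<mapsto> pdual (trS S), y \<mapsto> pdual (pdual (trS S)))"
    by (auto simp: \<Lambda>_def ctx_simps split: option.split)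
  finally have "Res x y (trB B (dom \<Lambda>) x (trC D w)) \<turnstile>\<^sup>* (dual_env \<Gamma> ++ dual_env \<Delta>)(w \<mapsto> trT T)"
    by (rule ptyping.Res) auto
  then have "(Res x y (trB B (dom \<Lambda>) x (trC D w)))\<lbrace>z/w\<rbrace> \<turnstile>\<^sup>* (dual_env \<Gamma> ++ dual_env \<Delta>)(z \<mapsto> trT T)"
    by (intro ptyping_ren) (use ResBuf.prems in auto)
  then show ?case
    unfolding trC.simps Let_def w_def[symmetric] L by simp
next
  case (ConfSub D \<Gamma> x T \<phi> C U E \<Delta> M)
  define \<nu> where "\<nu> = fresh (domC D \<union> domM E \<union> {x, z})"
  have dom: "domC D = insert x (dom \<Gamma>)" "domM E = dom \<Delta>"
    and fin: "finite (dom \<Gamma>)" "finite (dom \<Delta>)"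
    using domC_eq[OF ConfSub.hyps(1)] domM_eq[OF ConfSub.hyps(2)] by auto
  note \<nu> = fresh[of "domC D \<union> domM E \<union> {x, z}", folded \<nu>_def, unfolded dom]
  have [simp]: "\<nu> i \<notin> dom \<Gamma>" "\<nu> i \<notin> dom \<Delta>" "\<nu> i \<noteq> x" "x \<noteq> \<nu> i" "\<nu> i \<noteq> z" "z \<noteq> \<nu> i"
      "\<nu> i = \<nu> j \<longleftrightarrow> i = j" for i j
    using \<nu>(1) \<nu>(2)[of i] fin by (auto simp: inj_eq)
  note [simp] = ConfSub.hyps(3,4)
  have body: "trC D (\<nu> 1) \<turnstile>\<^sup>* (dual_env \<Gamma>)(\<nu> 1 \<mapsto> trT U, x \<mapsto> pdual (trT T))"
    by (rule ptyping_cong[OF ConfSub.IH[of "\<nu> 1"]]) (simp_all add: fun_upd_twist)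
  have "FRes x (\<nu> 0) (trC D (\<nu> 1) \<parallel> trM E (\<nu> 0)) \<turnstile>\<^sup>* (dual_env \<Gamma> ++ dual_env \<Delta>)(\<nu> 1 \<mapsto> trT U)"
    by (rule ptyping_cong[OF ptyping_cut(2)[OF body ptyping_trM[OF ConfSub.hyps(2)]]])
      (use ConfSub.hyps in \<open>auto simp: disjoint_ctx_def map_add_upd_left\<close>)
  then have "(FRes x (\<nu> 0) (trC D (\<nu> 1) \<parallel> trM E (\<nu> 0)))\<lbrace>z/\<nu> 1\<rbrace> \<turnstile>\<^sup>*
      (dual_env \<Gamma> ++ dual_env \<Delta>)(z \<mapsto> trT U)"
    by (intro ptyping_ren) (use ConfSub.prems in auto)
  then show ?case
    unfolding trC.simps Let_def \<nu>_def[symmetric] by (simp del: ren.simps)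
qed

theorem theorem4p4:
  shows "(\<forall>D \<Gamma> M T z. D \<^bold>: \<Gamma> \<turnstile>\<^sub>M M : T \<longrightarrow> z \<notin> dom \<Gamma> \<longrightarrow>
            trM D z \<turnstile>\<^sup>* (dual_env \<Gamma>)(z \<mapsto> trT T))
       \<and> (\<forall>D \<Gamma> \<phi> C T z. D \<^bold>: \<Gamma> \<turnstile>\<^sub>C[\<phi>] C : T \<longrightarrow> z \<notin> dom \<Gamma> \<longrightarrow>
            trC D z \<turnstile>\<^sup>* (dual_env \<Gamma>)(z \<mapsto> trT T))
       \<and> (\<forall>B \<Gamma> ms S' S P \<Lambda> x. B \<^bold>: \<Gamma> \<turnstile>\<^sub>B [ms\<rangle> : S' > S \<longrightarrow>
            x \<notin> dom \<Lambda> \<longrightarrow> x \<notin> dom \<Gamma> \<longrightarrow> dual_env \<Gamma> \<bottom> \<Lambda> \<longrightarrow>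
            P \<turnstile>\<^sup>* \<Lambda>(x \<mapsto> pdual (trS S')) \<longrightarrow>
            trB B (dom \<Lambda>) x P \<turnstile>\<^sup>* (dual_env \<Gamma> ++ \<Lambda>)(x \<mapsto> pdual (trS S)))"
proof (intro conjI allI impI)
  fix B \<Gamma> ms S' S P x and \<Lambda> :: "name \<rightharpoonup> pty"
  assume "B \<^bold>: \<Gamma> \<turnstile>\<^sub>B [ms\<rangle> : S' > S" "x \<notin> dom \<Lambda>" "x \<notin> dom \<Gamma>" "dual_env \<Gamma> \<bottom> \<Lambda>"
    "P \<turnstile>\<^sup>* \<Lambda>(x \<mapsto> pdual (trS S'))"
  then show "trB B (dom \<Lambda>) x P \<turnstile>\<^sup>* (dual_env \<Gamma> ++ \<Lambda>)(x \<mapsto> pdual (trS S))"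
    by (intro ptyping_trB) (auto simp: disjoint_ctx_def)
qed (auto intro: ptyping_trM ptyping_trC)

end
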